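(* Let $r$ be a positive integer, $m\ge 0$ an integer, and let $\lambda=(\lambda_1,\dots,\lambda_\ell)$ be a partition whose conjugate $\mu=\lambda^t=(\mu_1,\dots,\mu_{\lambda_1})$ satisfies $\mu_{\lambda_1}>r$. Put $n=\lambda_{r+1}+\cdots+\lambda_\ell$ and $\lambda'=(\lambda_1+m,\dots,\lambda_r+m,\lambda_{r+1},\dots,\lambda_\ell)$. Let $p\in\mathcal{M}(\lambda)$, $\alpha\in\mathcal{S}(n,m)$, and $p'=\psi^{(r)}(\alpha,p)\in\mathcal{M}(\lambda')$. Then $$\mathsf{maj}(p')=\mathsf{maj}(p)+\mathsf{add}(\alpha)+m(r-1)\cdot\left(\mathsf{len}(p)+\frac{rm}{2}\right),$$ $$\mathsf{comaj}(p')=\mathsf{comaj}(p)-\mathsf{add}(\alpha)+m\cdot\mathsf{len}(p)+r\binom{m}{2}.$$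
   Context: Motzkin paths. A Motzkin path of length $n$ is a lattice path from $(0,0)$ to $(n,0)$ with steps $U=(1,1)$, $H=(1,0)$, $D=(1,-1)$ staying weakly above the $x$-axis; $\mathcal{M}(n)$ is the set of these, and $\mathsf{len}(p)$ is the length of $p$. $\oplus$ denotes concatenation of paths. A block is either a single $H$ step on its base line, or a sequence of steps starting with a $U$ step from the base line and ending with the first $D$ step returning to the base line afterwards (the base line is the $x$-axis unless stated otherwise). The unit Motzkin path $u^{(j)}$ of length $j\ge1$ is $U^{j/2}D^{j/2}$ if $j$ is even and $U^{(j-1)/2}HD^{(j-1)/2}$ if $j$ is odd. A unital segment of a Motzkin path is a maximal sequence of consecutive steps forming a unit Motzkin path (up to translation; it need not start on the $x$-axis). For a path $p$ with maximal height $y(p)$ (measured relative to its base line, or equivalently in absolute coordinates when comparing blocks on the same base line), $\mathsf{ht}(p)=y(p)+\frac12$ if $p$ has an $H$ step at the maximal height, and $\mathsf{ht}(p)=y(p)$ otherwise. Statistics. For $p\in\mathcal{M}(n)$, an index $i\in\{1,\dots,n-1\}$ is a weak valley of $p$ if steps $i,i+1$ are $HH$, $DU$, $DH$, or $HU$, and a weak peak if they are $UD$, $UU$, $DD$, $UH$, or $HD$. $\mathsf{maj}(p)$ is the sum of the weak peaks and $\mathsf{comaj}(p)$ the sum of the weak valleys. Shape algorithm. Given $p\in\mathcal{M}(n)$, set $\overline p=p$. (1) Let $\overline p=p_1\oplus\cdots\oplus p_s$ be the decomposition into blocks. If all $p_i$ are unit Motzkin paths go to (3), else go to (2). (2) Let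 $i$ be least such that $p_i$ is not a unit Motzkin path. Let $M$ be the greatest integer such that $p_i=U^M\oplus q_1\oplus\cdots\oplus q_k\oplus D^M$ with each $q_j$ a block with base line $y=M$. Let $t$ be the least index for which $\mathsf{ht}(q_t)$ is maximal among $\mathsf{ht}(q_1),\dots,\mathsf{ht}(q_k)$. Replace $p_i$ in $\overline p$ by $p_i'=q_1\oplus\cdots\oplus q_{t-1}\oplus U^M\oplus q_t\oplus D^M\oplus q_{t+1}\oplus\cdots\oplus q_k$ and return to (1). (3) Set $p_{\mathsf{min}}=\overline p$; let $\mu$ be the partition of $n$ formed by the lengths of $p_1,\dots,p_s$ in decreasing order, and let $\theta(p)=\mu^t$ be its conjugate. $p$ has shape $\lambda$ if $\theta(p)=\lambda$, and $\mathcal{M}(\lambda)$ is the set of Motzkin paths of shape $\lambda$. $\mathcal{S}(n,m)=\{(a_1,\dots,a_m): 0\le a_1\le\cdots\le a_m\le n\}$, a set of integer sequences ($\mathcal{S}(n,0)$ contains only the empty sequence); $\mathsf{add}(\alpha)=a_1+\cdots+a_m$, with $\mathsf{add}=0$ for the empty sequence. The map $\psi^{(r)}:\mathcal{S}(n,m)\times\mathcal{M}(\lambda)\to\mathcal{M}(\lambda')$. Given $\alpha=(a_1,\dots,a_m)\in\mathcal{S}(n,m)$ and $p\in\mathcal{M}(\lambda)$: (i) for each unital segment of $p$, mark $r$ of its lattice points, processed from top to bottom, and, when two candidate points lie at the same height, marking the left one first; (ii) label all unmarked lattice points of $p$ by $0,1,\dots,n$ from right to left; (iii) for each $i=1,\dots,m$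 insert a copy of $u^{(r)}$ at the point labeled $a_i$, so that the right endpoint of the inserted $u^{(r)}$ then carries the label $a_i$. The resulting path is $\psi^{(r)}(\alpha,p)$. For $m=0$, $\psi^{(r)}$ is the identity. *)

theory Defs
  imports Complex_Main "HOL-Library.While_Combinator"
begin

text \<open>Lattice paths are step words. Concatenation of paths is list append, and the lattice points
  of a path \<open>p\<close> are named by their abscissa \<open>0, \<dots>, length p\<close> relative to the start of \<open>p\<close>. Steps are
  numbered from \<open>1\<close> in the mathematics, so that step \<open>i\<close> is \<open>p ! (i - 1)\<close>.\<close>

datatype step = U | H | D

type_synonym path = "step list"

fun rise :: "step \<Rightarrow> int" where
  "rise U = 1"
| "rise H = 0"
| "rise D = -1"

definition height :: "path \<Rightarrow> nat \<Rightarrow> int" where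
  "height p j = sum_list (map rise (take j p))"

definition motzkin :: "path \<Rightarrow> bool" where
  "motzkin p \<longleftrightarrow> (\<forall>j\<le>length p. 0 \<le> height p j) \<and> height p (length p) = 0"

text \<open>A block is described relative to its own base line, so the same predicate serves for blocks
  with base line \<open>y = M\<close>.\<close>

definition is_block :: "path \<Rightarrow> bool" where
  "is_block b \<longleftrightarrow> b = [H] \<or>
     (b \<noteq> [] \<and> hd b = U \<and> last b = D \<and> height b (length b) = 0 \<and>
      (\<forall>j. 0 < j \<and> j < length b \<longrightarrow> 0 < height b j))"

definition is_block_decomp :: "path list \<Rightarrow> path \<Rightarrow> bool" where
  "is_block_decomp bs p \<longleftrightarrow> (\<forall>b\<in>set bs. is_block b) \<and> concat bs = p"

definition blocks :: "path \<Rightarrow> path list" where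
  "blocks p = (THE bs. is_block_decomp bs p)"

definition unit_path :: "nat \<Rightarrow> path" where
  "unit_path j = replicate (j div 2) U @ (if odd j then [H] else []) @ replicate (j div 2) D"

definition is_unit_path :: "path \<Rightarrow> bool" where
  "is_unit_path p \<longleftrightarrow> (\<exists>j\<ge>1. p = unit_path j)"

text \<open>A segment is given as \<open>(i, k)\<close>: the \<open>k\<close> consecutive steps of \<open>p\<close> that start at the lattice
  point with abscissa \<open>i\<close>.\<close>

definition unit_segment :: "path \<Rightarrow> nat \<times> nat \<Rightarrow> bool" where
  "unit_segment p = (\<lambda>(i, k). i + k \<le> length p \<and> is_unit_path (take k (drop i p)))"

definition unital_segments :: "path \<Rightarrow> (nat \<times> nat) set" where
  "unital_segments p = {(i, k). unit_segment p (i, k) \<and>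
     (\<forall>i' k'. unit_segment p (i', k') \<and> i' \<le> i \<and> i + k \<le> i' + k' \<longrightarrow> (i', k') = (i, k))}"

definition max_height :: "path \<Rightarrow> int" where
  "max_height p = Max (height p ` {0..length p})"

definition ht :: "path \<Rightarrow> real" where
  "ht p = (if \<exists>i<length p. p ! i = H \<and> height p i = max_height p
           then of_int (max_height p) + 1 / 2 else of_int (max_height p))"

definition weak_valleys :: "path \<Rightarrow> nat set" where
  "weak_valleys p = {i. 1 \<le> i \<and> i < length p \<and>
     (p ! (i - 1), p ! i) \<in> {(H, H), (D, U), (D, H), (H, U)}}"

definition weak_peaks :: "path \<Rightarrow> nat set" where
  "weak_peaks p = {i. 1 \<le> i \<and> i < length p \<and>
     (p ! (i - 1), p ! i) \<in> {(U, D), (U, U), (D, D), (U, H), (H, D)}}"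

definition maj :: "path \<Rightarrow> nat" where
  "maj p = \<Sum>(weak_peaks p)"

definition comaj :: "path \<Rightarrow> nat" where
  "comaj p = \<Sum>(weak_valleys p)"

text \<open>Partitions are weakly decreasing lists of positive integers; \<open>\<lambda>\<^sub>i\<close> is \<open>l ! (i - 1)\<close>.\<close>

definition is_partition :: "nat list \<Rightarrow> bool" where
  "is_partition l \<longleftrightarrow> sorted_wrt (\<ge>) l \<and> (\<forall>x\<in>set l. 0 < x)"

definition conjugate :: "nat list \<Rightarrow> nat list" where
  "conjugate l =
     (if l = [] then [] else map (\<lambda>j. length (filter (\<lambda>x. j \<le> x) l)) [1..<Suc (hd l)])"

text \<open>The shape algorithm. \<open>lift_highest\<close> is the replacement of a non-unit block \<open>p\<^sub>i\<close> by \<open>p\<^sub>i'\<close>.\<close>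

definition core_decomp :: "path \<Rightarrow> nat \<Rightarrow> path list \<Rightarrow> bool" where
  "core_decomp b M qs \<longleftrightarrow>
     b = replicate M U @ concat qs @ replicate M D \<and> (\<forall>q\<in>set qs. is_block q)"

definition lift_highest :: "path \<Rightarrow> path" where
  "lift_highest b =
     (let M = (GREATEST M. \<exists>qs. core_decomp b M qs);
          qs = (THE qs. core_decomp b M qs);
          t = (LEAST t. t < length qs \<and> (\<forall>j<length qs. ht (qs ! j) \<le> ht (qs ! t)))
      in concat (take t qs) @ replicate M U @ qs ! t @ replicate M D @ concat (drop (Suc t) qs))"

definition all_unit :: "path \<Rightarrow> bool" where
  "all_unit p \<longleftrightarrow> (\<forall>b\<in>set (blocks p). is_unit_path b)"

definition shape_step :: "path \<Rightarrow> path" where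
  "shape_step p =
     (let bs = blocks p;
          i = (LEAST i. i < length bs \<and> \<not> is_unit_path (bs ! i))
      in concat (take i bs) @ lift_highest (bs ! i) @ concat (drop (Suc i) bs))"

definition p_min :: "path \<Rightarrow> path" where
  "p_min p = while (\<lambda>q. \<not> all_unit q) shape_step p"

definition theta :: "path \<Rightarrow> nat list" where
  "theta p = conjugate (rev (sort (map length (blocks (p_min p)))))"

definition paths_of_shape :: "nat list \<Rightarrow> path set" where
  "paths_of_shape l = {p. motzkin p \<and> theta p = l}"

definition inc_seqs :: "nat \<Rightarrow> nat \<Rightarrow> nat list set" where
  "inc_seqs n m = {\<alpha>. length \<alpha> = m \<and> sorted \<alpha> \<and> (\<forall>a\<in>set \<alpha>. a \<le> n)}"

definition add :: "nat list \<Rightarrow> nat" where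
  "add \<alpha> = sum_list \<alpha>"

text \<open>\<open>sort_key\<close> is stable, so points of equal height are taken from left to right.\<close>

definition segment_marks :: "nat \<Rightarrow> path \<Rightarrow> nat \<times> nat \<Rightarrow> nat set" where
  "segment_marks r p = (\<lambda>(i, k). set (take r (sort_key (\<lambda>j. - height p j) [i..<Suc (i + k)])))"

definition marked :: "nat \<Rightarrow> path \<Rightarrow> nat set" where
  "marked r p = (\<Union>s\<in>unital_segments p. segment_marks r p s)"

text \<open>The entry at index \<open>a\<close> of this list is the lattice point labeled \<open>a\<close>.\<close>

definition labeled_points :: "nat \<Rightarrow> path \<Rightarrow> nat list" where
  "labeled_points r p = rev (filter (\<lambda>j. j \<notin> marked r p) [0..<Suc (length p)])"

text \<open>The argument \<open>pos\<close> gives the current abscissa of the point carrying a label. An insertion at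
  the point labeled \<open>a\<close> shifts that point and all points to its right by \<open>r\<close>, so that label \<open>a\<close> is
  afterwards carried by the right endpoint of the inserted path.\<close>

fun insert_units :: "nat \<Rightarrow> nat list \<Rightarrow> (nat \<Rightarrow> nat) \<Rightarrow> path \<Rightarrow> path" where
  "insert_units r [] pos q = q"
| "insert_units r (a # \<alpha>) pos q =
     insert_units r \<alpha> (\<lambda>b. if pos b < pos a then pos b else pos b + r)
       (take (pos a) q @ unit_path r @ drop (pos a) q)"

definition psi :: "nat \<Rightarrow> nat list \<Rightarrow> path \<Rightarrow> path" where
  "psi r \<alpha> p = insert_units r \<alpha> (\<lambda>a. labeled_points r p ! a) p"

end

theory Submission
  imports Defs "HOL-Library.Multiset"
begin

text \<open>Read a Motzkin path as a plane forest whose blocks are the trees. The shape algorithm splits this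
  forest into chains: at each node the highest child (weight \<open>2\<close> per nested pair \<open>U\<close>, \<open>D\<close>, weight
  \<open>1\<close> for \<open>H\<close>) continues the chain of its parent, and every other child starts a new one. A chain of
  length \<open>L\<close> consists of subblocks of weighted heights \<open>L, L - 2, \<dots>\<close>, so the multiset of the weighted
  heights of all subblocks, which the algorithm visibly preserves, determines the shape.
  Inserting \<open>u\<^sup>(\<^sup>r\<^sup>)\<close> where all enclosing blocks keep their height adds the heights \<open>r, r - 2, \<dots>\<close>,
  hence one more part \<open>r\<close>. If all parts exceed \<open>r\<close>, so do all unital segments, and the unmarked
  points are such places.

  Inserting \<open>u\<^sup>(\<^sup>r\<^sup>)\<close> at abscissa \<open>x\<close>, not a peak, raises \<open>comaj\<close> by \<open>x\<close> plus \<open>r\<close> for each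
  unital segment to the right of \<open>x\<close>. The points to the right of \<open>x\<close> are the unmarked ones, counted by
  the label \<open>a\<close> of \<open>x\<close>, and \<open>r\<close> marked ones per unital segment, so the increase is \<open>len - a\<close>; each
  earlier insertion lies to the right and contributes a further \<open>r\<close>. The formula for \<open>maj\<close> follows because every interior
  index is a weak peak or a weak valley.\<close>

section \<open>Motzkin paths as trees\<close>

text \<open>First-return decomposition: a nonempty Motzkin path starts with an H, or with a U and
  its matching D. Recursion on it replaces most arguments about heights.\<close>

datatype motz = Empty | Flat motz | Arch motz motz

fun word :: "motz \<Rightarrow> path" where
  "word Empty = []"
| "word (Flat t) = H # word t"
| "word (Arch s t) = U # word s @ D # word t"

text \<open>Twice \<open>ht\<close>, so that the half unit of an H step at the top becomes an
  integer; see \<open>ht_word\<close>.\<close>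

fun peak :: "motz \<Rightarrow> nat" where
  "peak Empty = 0"
| "peak (Flat t) = max 1 (peak t)"
| "peak (Arch s t) = max (2 + peak s) (peak t)"

fun longs :: "motz \<Rightarrow> nat multiset" where
  "longs Empty = {#}"
| "longs (Flat t) = add_mset 1 (longs t)"
| "longs (Arch s t) = add_mset (2 + peak s) (longs s + longs t)"

fun join :: "motz \<Rightarrow> motz \<Rightarrow> motz" where
  "join Empty u = u"
| "join (Flat t) u = Flat (join t u)"
| "join (Arch s t) u = Arch s (join t u)"

fun tops :: "motz \<Rightarrow> path list" where
  "tops Empty = []"
| "tops (Flat t) = [H] # tops t"
| "tops (Arch s t) = (U # word s @ [D]) # tops t"

lemma word_join [simp]: "word (join s t) = word s @ word t"
  by (induction s) auto

lemma peak_join [simp]: "peak (join s t) = max (peak s) (peak t)"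
  by (induction s) auto

lemma longs_join [simp]: "longs (join s t) = longs s + longs t"
  by (induction s) auto

lemma peak_eq_0_iff [simp]: "peak t = 0 \<longleftrightarrow> t = Empty"
  by (cases t) auto

lemma height_0 [simp]: "height p 0 = 0"
  by (simp add: height_def)

lemma height_Nil [simp]: "height [] j = 0"
  by (simp add: height_def)

lemma height_Cons_Suc [simp]: "height (s # p) (Suc j) = rise s + height p j"
  by (simp add: height_def)

lemma height_append: "height (p @ q) j = height p j + height q (j - length p)"
  by (simp add: height_def)

lemma height_beyond: "length p \<le> j \<Longrightarrow> height p j = height p (length p)"
  by (simp add: height_def)

lemma word_height_end: "length (word t) \<le> j \<Longrightarrow> height (word t) j = 0"
proof (induction t arbitrary: j)
  case (Flat t) then show ?case by (cases j) auto
next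
  case (Arch s t)
  then obtain i where "j = Suc (Suc (length (word s) + i))" "length (word t) \<le> i"
    using le_Suc_ex[of "Suc (Suc (length (word s) + length (word t)))" j] by auto
  then show ?case using Arch.IH by (simp add: height_append Suc_diff_le)
qed simp

lemma word_height_nonneg: "0 \<le> height (word t) j"
proof (induction t arbitrary: j)
  case (Flat t) then show ?case by (cases j) auto
next
  case (Arch s t)
  show ?case
  proof (cases j)
    case (Suc i)
    show ?thesis
    proof (cases "i \<le> length (word s)")
      case True
      then show ?thesis using Suc Arch.IH(1)[of i] by (simp add: height_append)
    next
      case False
      then obtain k where "i = Suc (length (word s) + k)"
        using less_imp_Suc_add not_le_imp_less by blast
      then show ?thesis using Suc Arch.IH by (simp add: height_append word_height_end Suc_diff_le)
    qed
  qed simp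
qed simp

lemma motzkin_word: "motzkin (word t)"
  by (simp add: motzkin_def word_height_nonneg word_height_end)

text \<open>In the second alternative \<open>q\<close> is empty or starts with a \<open>U\<close> that is never matched.\<close>

lemma word_prefix:
  "\<exists>t q. p = word t @ q \<and> ((\<exists>q'. q = D # q') \<or> (\<forall>j. 0 < j \<and> j \<le> length q \<longrightarrow> 0 < height q j))"
proof (induction "length p" arbitrary: p rule: less_induct)
  case less
  show ?case
  proof (cases p)
    case Nil
    then show ?thesis by (intro exI[of _ Empty]) auto
  next
    case (Cons s p')
    obtain t q where tq: "p' = word t @ q"
      "(\<exists>q'. q = D # q') \<or> (\<forall>j. 0 < j \<and> j \<le> length q \<longrightarrow> 0 < height q j)"
      using less[of p'] Cons by auto
    show ?thesis
    proof (cases s)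
      case H
      show ?thesis using tq Cons H by (intro exI[of _ "Flat t"] exI[of _ q]) auto
    next
      case D
      show ?thesis using Cons D by (intro exI[of _ Empty]) auto
    next
      case U
      show ?thesis
      proof (cases "\<exists>q'. q = D # q'")
        case True
        then obtain q' where q': "q = D # q'" by blast
        obtain t' q'' where "q' = word t' @ q''"
          "(\<exists>q'. q'' = D # q') \<or> (\<forall>j. 0 < j \<and> j \<le> length q'' \<longrightarrow> 0 < height q'' j)"
          using less[of q'] Cons tq(1) q' by auto
        then show ?thesis using q' tq(1) Cons U
          by (intro exI[of _ "Arch t t'"] exI[of _ q'']) auto
      next
        case False
        \<comment> \<open>With no D to match it, the leading U lifts everything after it above the
          start, so all of \<open>p\<close> becomes the remainder.\<close>
        have "0 < height p j" if j: "0 < j" "j \<le> length p" for j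
        proof -
          obtain i where i: "j = Suc i" using j(1) by (cases j) auto
          have "0 \<le> height q (i - length (word t))"
            using False tq j(2) i Cons
            by (cases "i - length (word t) = 0") (auto simp: less_imp_le)
          then show ?thesis using word_height_nonneg[of t i]
            by (simp add: i Cons U tq(1) height_append)
        qed
        then show ?thesis by (intro exI[of _ Empty] exI[of _ p]) auto
      qed
    qed
  qed
qed

text \<open>The remainder left by \<open>word_prefix\<close> must be empty: a leading D would go
  below the axis, and an unmatched U would leave the endpoint above it.\<close>

lemma motzkin_iff_word: "motzkin p \<longleftrightarrow> (\<exists>t. p = word t)"
proof
  assume m: "motzkin p"
  obtain t q where tq: "p = word t @ q"
    "(\<exists>q'. q = D # q') \<or> (\<forall>j. 0 < j \<and> j \<le> length q \<longrightarrow> 0 < height q j)"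
    using word_prefix by blast
  have "q = []"
  proof (rule ccontr)
    assume "q \<noteq> []"
    show False using tq(2)
    proof
      assume "\<exists>q'. q = D # q'"
      then have "height p (Suc (length (word t))) = - 1" "Suc (length (word t)) \<le> length p"
        by (auto simp: tq(1) height_append word_height_end)
      then show False using m by (auto simp: motzkin_def)
    next
      assume "\<forall>j. 0 < j \<and> j \<le> length q \<longrightarrow> 0 < height q j"
      then have "0 < height p (length p)" using \<open>q \<noteq> []\<close>
        by (simp add: tq(1) height_append word_height_end)
      then show False using m by (simp add: motzkin_def)
    qed
  qed
  then show "\<exists>t. p = word t" using tq(1) by auto
qed (auto simp: motzkin_word)

text \<open>The D that closes an arch is an end marker, so parsing is unique. The continuations
  \<open>x\<close> and \<open>y\<close> are arbitrary because, for an arch, the induction hypothesis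
  is applied to the inner word followed by everything after it.\<close>

lemma word_D_inject: "word s @ D # x = word s' @ D # y \<Longrightarrow> s = s' \<and> x = y"
proof (induction s arbitrary: s' x y)
  case Empty then show ?case by (cases s') auto
next
  case (Flat s) then show ?case by (cases s') auto
next
  case (Arch a b)
  obtain a' b' where s': "s' = Arch a' b'" using Arch.prems by (cases s') auto
  show ?case using Arch.prems Arch.IH(1)[of "word b @ D # x" a' "word b' @ D # y"]
      Arch.IH(2)[of x b' y] by (simp add: s')
qed

lemma word_inject: "word s = word t \<longleftrightarrow> s = t"
  using word_D_inject[of s "[]" t "[]"] by auto

lemma concat_tops [simp]: "concat (tops t) = word t"
  by (induction t) auto

text \<open>A block other than H is strictly positive inside; stripping its outer U and D lowers the
  inside by one, which leaves a Motzkin path.\<close>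

lemma is_block_iff: "is_block b \<longleftrightarrow> b = [H] \<or> (\<exists>s. b = U # word s @ [D])"
proof
  assume b: "is_block b"
  show "b = [H] \<or> (\<exists>s. b = U # word s @ [D])"
  proof (cases "b = [H]")
    case False
    then have *: "b \<noteq> []" "hd b = U" "last b = D" "height b (length b) = 0"
      "\<And>j. 0 < j \<Longrightarrow> j < length b \<Longrightarrow> 0 < height b j"
      using b by (auto simp: is_block_def)
    obtain b' where b': "b = U # b'" using * by (cases b) auto
    then obtain c where c: "b = U # c @ [D]" using * by (cases b' rule: rev_cases) auto
    have "0 \<le> height c j" if "j \<le> length c" for j
      using *(5)[of "Suc j"] that by (simp add: c height_append)
    moreover have "height c (length c) = 0"
      using *(4) height_beyond[of c "Suc (length c)"] by (simp add: c height_append)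
    ultimately have "motzkin c" by (simp add: motzkin_def)
    then show ?thesis using c by (auto simp: motzkin_iff_word)
  qed simp
next
  assume "b = [H] \<or> (\<exists>s. b = U # word s @ [D])"
  moreover have "is_block (U # word s @ [D])" for s
  proof -
    have "0 < height (U # word s @ [D]) j" if "0 < j" "j < length (U # word s @ [D])" for j
      using that word_height_nonneg[of s "j - 1"] by (cases j) (auto simp: height_append)
    then show ?thesis by (auto simp: is_block_def height_append word_height_end)
  qed
  ultimately show "is_block b" by (auto simp: is_block_def)
qed

lemma is_block_tops: "b \<in> set (tops t) \<Longrightarrow> is_block b"
  by (induction t) (auto simp: is_block_iff)

text \<open>The first step tells the kind of the first block, and \<open>word_D_inject\<close> fixes
  where an arch closes. This evaluates the \<open>THE\<close> in \<open>blocks\<close>.\<close>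

lemma block_decomp_unique: "\<forall>b\<in>set bs. is_block b \<Longrightarrow> concat bs = word t \<Longrightarrow> bs = tops t"
proof (induction t arbitrary: bs)
  case Empty
  then show ?case by (cases bs) (auto simp: is_block_iff)
next
  case (Flat t)
  then obtain b bs' where bs: "bs = b # bs'" by (cases bs) auto
  then have "b = [H]" using Flat.prems by (auto simp: is_block_iff)
  then show ?case using Flat bs by auto
next
  case (Arch s t)
  then obtain b bs' where bs: "bs = b # bs'" by (cases bs) auto
  then obtain s' where s': "b = U # word s' @ [D]" using Arch.prems by (auto simp: is_block_iff)
  then have "s' = s \<and> concat bs' = word t"
    using Arch.prems bs word_D_inject[of s' "concat bs'" s "word t"] by simp
  then show ?case using Arch.IH(2)[of bs'] Arch.prems bs s' by auto
qed

lemma blocks_word: "blocks (word t) = tops t"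
  unfolding blocks_def is_block_decomp_def
  by (rule the_equality) (auto intro: is_block_tops block_decomp_unique)

section \<open>Invariance of the chain lengths under the shape algorithm\<close>

text \<open>Doubling turns \<open>ht\<close> into the maximum of one integer-valued function of the
  abscissa, which can be computed along the tree.\<close>

definition elevation :: "path \<Rightarrow> nat \<Rightarrow> int" where
  "elevation p j = 2 * height p j + (if j < length p \<and> p ! j = H then 1 else 0)"

lemma elevation_Nil [simp]: "elevation [] j = 0"
  by (simp add: elevation_def)

lemma elevation_Cons_0 [simp]: "elevation (s # p) 0 = (if s = H then 1 else 0)"
  by (simp add: elevation_def)

lemma elevation_Cons_Suc [simp]: "elevation (s # p) (Suc j) = 2 * rise s + elevation p j"
  by (simp add: elevation_def)

lemma elevation_append:
  "elevation (p @ q) j = (if j < length p then elevation p j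
     else 2 * height p (length p) + elevation q (j - length p))"
  by (auto simp: elevation_def height_append nth_append height_beyond[of p j])

lemma elevation_word_le: "elevation (word t) j \<le> int (peak t)"
proof (induction t arbitrary: j)
  case (Flat t)
  show ?case
  proof (cases j)
    case (Suc i) then show ?thesis using Flat.IH[of i] by (simp add: le_max_iff_disj of_nat_max)
  qed simp
next
  case (Arch s t)
  \<comment> \<open>The start, a point of \<open>s\<close> before its end, the point before the
    closing D, and a point of \<open>t\<close>.\<close>
  consider "j = 0" | i where "j = Suc i" "i < length (word s)" | "j = Suc (length (word s))"
    | k where "j = Suc (length (word s) + Suc k)"
    by (metis add_Suc_right less_imp_Suc_add linorder_neqE_nat not0_implies_Suc)
  then show ?case
  proof cases
    case 2 then show ?thesis using Arch.IH(1)[of i] by (simp add: elevation_append)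
  next
    case 4 then show ?thesis using Arch.IH(2)[of k] by (simp add: elevation_append word_height_end)
  qed (simp_all add: elevation_append word_height_end)
qed simp

lemma elevation_word_attained: "\<exists>j\<le>length (word t). elevation (word t) j = int (peak t)"
proof (induction t)
  case (Flat t)
  then obtain j where j: "j \<le> length (word t)" "elevation (word t) j = int (peak t)" by blast
  show ?case
  proof (cases "peak t = 0")
    case False
    then have "peak (Flat t) = peak t" by (simp del: peak_eq_0_iff)
    then show ?thesis using j by (intro exI[of _ "Suc j"]) auto
  qed (auto intro!: exI[of _ 0])
next
  case (Arch s t)
  then obtain i j where i: "i \<le> length (word s)" "elevation (word s) i = int (peak s)"
    and j: "j \<le> length (word t)" "elevation (word t) j = int (peak t)" by blast
  show ?case
  proof (cases "2 + peak s \<le> peak t")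
    case True
    then show ?thesis using j
      by (intro exI[of _ "Suc (length (word s) + Suc j)"])
        (auto simp: elevation_append word_height_end)
  next
    case False
    \<comment> \<open>The maximum of \<open>s\<close> may sit at its last point; the step that
      follows there is D and adds nothing.\<close>
    have "elevation (word s @ D # word t) i = int (peak s)"
    proof (cases "i < length (word s)")
      case False
      then have "i = length (word s)" using i by simp
      then show ?thesis using i(2) by (simp add: elevation_append elevation_def word_height_end)
    qed (use i in \<open>simp add: elevation_append\<close>)
    then show ?thesis using False i by (intro exI[of _ "Suc i"]) auto
  qed
qed simp

text \<open>Height counts double and an H step only once in \<open>elevation\<close>, so a point of
  maximal elevation has maximal height, and the parity of the maximum tells whether an H step lies
  at that height.\<close>

lemma ht_word: "ht (word t) = real (peak t) / 2"
proof -
  let ?p = "word t"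
  have le: "2 * height ?p j + (if j < length ?p \<and> ?p ! j = H then 1 else 0) \<le> int (peak t)" for j
    using elevation_word_le[of t j] by (simp add: elevation_def)
  obtain j where j: "j \<le> length ?p" "elevation ?p j = int (peak t)"
    using elevation_word_attained by blast
  have max: "max_height ?p = height ?p j"
    unfolding max_height_def
  proof (rule Max_eqI)
    fix y assume "y \<in> height ?p ` {0..length ?p}"
    then obtain i where "y = height ?p i" by blast
    then show "y \<le> height ?p j" using le[of i] j(2)
      by (auto simp: elevation_def split: if_splits)
  qed (use j in auto)
  show ?thesis
  proof (cases "j < length ?p \<and> ?p ! j = H")
    case True
    then have "\<exists>i<length ?p. ?p ! i = H \<and> height ?p i = max_height ?p" using max by auto
    then have "ht ?p = real_of_int (height ?p j) + 1 / 2" unfolding ht_def max by simp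
    moreover have "int (peak t) = 2 * height ?p j + 1" using j(2) True by (simp add: elevation_def)
    then have "real (peak t) = 2 * real_of_int (height ?p j) + 1" by linarith
    ultimately show ?thesis by simp
  next
    case False
    have peak: "int (peak t) = 2 * height ?p j" using j(2) False by (auto simp: elevation_def)
    have "\<not> (\<exists>i<length ?p. ?p ! i = H \<and> height ?p i = max_height ?p)"
    proof
      assume "\<exists>i<length ?p. ?p ! i = H \<and> height ?p i = max_height ?p"
      then obtain i where "i < length ?p" "?p ! i = H" "height ?p i = height ?p j" using max by auto
      then show False using le[of i] peak by simp
    qed
    then have "ht ?p = real_of_int (height ?p j)" unfolding ht_def max by simp
    moreover have "real (peak t) = 2 * real_of_int (height ?p j)" using peak by linarith
    ultimately show ?thesis by simp
  qed
qed

section \<open>Forests as lists of trees, and one step of the shape algorithm\<close>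

definition joins :: "motz list \<Rightarrow> motz" where
  "joins ts = foldr join ts Empty"

lemma joins_simps [simp]: "joins [] = Empty" "joins (t # ts) = join t (joins ts)"
  by (simp_all add: joins_def)

lemma word_joins: "word (joins ts) = concat (map word ts)"
  by (induction ts) auto

lemma longs_joins: "longs (joins ts) = sum_list (map longs ts)"
  by (induction ts) auto

lemma tops_join [simp]: "tops (join s t) = tops s @ tops t"
  by (induction s) auto

lemma length_tops_joins: "length (tops (joins ts)) = sum_list (map (length \<circ> tops) ts)"
  by (induction ts) auto

lemma peak_joins: "t \<in> set ts \<Longrightarrow> \<forall>s\<in>set ts. peak s \<le> peak t \<Longrightarrow> peak (joins ts) = peak t"
proof -
  have le: "peak s \<le> peak (joins ts)" if "s \<in> set ts" for s ts
    using that by (induction ts) (auto simp: le_max_iff_disj)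
  have "peak (joins ts) \<le> m" if "\<forall>s\<in>set ts. peak s \<le> m" for ts m
    using that by (induction ts) auto
  then show "t \<in> set ts \<Longrightarrow> \<forall>s\<in>set ts. peak s \<le> peak t \<Longrightarrow> peak (joins ts) = peak t"
    using le by (simp add: le_antisym)
qed

lemma blocks_as_words:
  assumes "\<forall>b\<in>set bs. is_block b"
  obtains ts where "bs = map word ts" "\<forall>t\<in>set ts. length (tops t) = 1"
proof -
  have "\<exists>t. b = word t \<and> length (tops t) = 1" if b: "is_block b" for b
  proof (cases "b = [H]")
    case True
    then show ?thesis by (intro exI[of _ "Flat Empty"]) auto
  next
    case False
    then obtain s where "b = U # word s @ [D]" using b by (auto simp: is_block_iff)
    then show ?thesis by (intro exI[of _ "Arch s Empty"]) auto
  qed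
  then have "\<exists>ts. bs = map word ts \<and> (\<forall>t\<in>set ts. length (tops t) = 1)"
    using assms
  proof (induction bs)
    case (Cons b bs)
    from Cons.prems(1)[of b] Cons.prems(2) obtain t where "b = word t" "length (tops t) = 1"
      by auto
    moreover have "\<forall>b\<in>set bs. is_block b" using Cons.prems(2) by simp
    with Cons.IH Cons.prems(1) obtain ts where "bs = map word ts"
      "\<forall>t\<in>set ts. length (tops t) = 1" by metis
    ultimately    show ?case by (intro exI[of _ "t # ts"]) auto
  qed simp
  then show ?thesis using that by blast
qed

definition wrap :: "nat \<Rightarrow> motz \<Rightarrow> motz" where
  "wrap M = (\<lambda>s. Arch s Empty) ^^ M"

lemma wrap_simps [simp]: "wrap 0 s = s" "wrap (Suc M) s = Arch (wrap M s) Empty"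
  by (simp_all add: wrap_def)

lemma word_wrap: "word (wrap M s) = replicate M U @ word s @ replicate M D"
  by (induction M) (auto simp: replicate_append_same)

lemma peak_wrap: "peak (wrap M s) = 2 * M + peak s"
  by (induction M) auto

text \<open>The nested pairs put around a tree add weighted heights that depend only on its
  peak.\<close>

lemma longs_wrap_exchange:
  "peak s = peak s' \<Longrightarrow> longs (wrap M s) + longs s' = longs (wrap M s') + longs s"
  by (induction M) (auto simp: peak_wrap add.commute)

lemma sum_list_nth_split:
  fixes f :: "'a \<Rightarrow> 'b :: comm_monoid_add"
  shows "i < length xs \<Longrightarrow>
    sum_list (map f xs) = sum_list (map f (take i xs)) + f (xs ! i) + sum_list (map f (drop (Suc i) xs))"
  by (subst id_take_nth_drop[of i xs], assumption) (simp add: add.assoc)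

text \<open>For fixed \<open>M\<close> the middle word is determined, hence so are its blocks; this
  evaluates the \<open>THE\<close> in \<open>lift_highest\<close>.\<close>

lemma core_decomp_unique:
  assumes "core_decomp b M qs" "core_decomp b M qs'"
  shows "qs = qs'"
proof -
  obtain ts where ts: "qs = map word ts"
    using assms(1) blocks_as_words[of qs] unfolding core_decomp_def by blast
  have "concat qs' = word (joins ts)" "concat qs = word (joins ts)"
    using assms ts by (auto simp: core_decomp_def word_joins)
  then show ?thesis using assms block_decomp_unique[of qs "joins ts"] block_decomp_unique[of qs' "joins ts"]
    by (auto simp: core_decomp_def)
qed

text \<open>Lifting moves \<open>M\<close> nested pairs from the whole forest to its highest block,
  which has the same peak, so \<open>longs_wrap_exchange\<close> applies. The gain in top-level
  blocks will give termination.\<close>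

lemma lift_highest_word:
  assumes nonunit: "\<not> is_unit_path (word (Arch s Empty))"
  obtains t' where "lift_highest (word (Arch s Empty)) = word t'"
    "longs t' = longs (Arch s Empty)" "1 < length (tops t')"
proof -
  define b where "b = word (Arch s Empty)"
  define M where "M = (GREATEST M. \<exists>qs. core_decomp b M qs)"
  have bound: "k \<le> length b" if "\<exists>qs. core_decomp b k qs" for k
    using that by (auto simp: core_decomp_def)
  \<comment> \<open>An arch always allows \<open>M = 1\<close>, so the greatest \<open>M\<close>
    exists and is positive.\<close>
  have one: "\<exists>qs. core_decomp b 1 qs"
    by (auto simp: core_decomp_def b_def intro!: exI[of _ "tops s"] is_block_tops)
  have M: "\<exists>qs. core_decomp b M qs"
    unfolding M_def by (rule GreatestI_nat[where P = "\<lambda>M. \<exists>qs. core_decomp b M qs", OF one])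
      (use bound in blast)
  have M_ge: "k \<le> M" if "\<exists>qs. core_decomp b k qs" for k
    unfolding M_def by (rule Greatest_le_nat[where P = "\<lambda>M. \<exists>qs. core_decomp b M qs", OF that])
      (use bound in blast)
  obtain qs where qs: "core_decomp b M qs" using M by blast
  have the_qs: "(THE qs. core_decomp b M qs) = qs"
    using qs core_decomp_unique by blast
  have b_eq: "b = replicate M U @ concat qs @ replicate M D" and blk: "\<forall>q\<in>set qs. is_block q"
    using qs by (auto simp: core_decomp_def)
  have M1: "1 \<le> M" using M_ge[OF one] .
  \<comment> \<open>With nothing or a single H in the middle, \<open>b\<close> would be a unit path;
    a single arch there could be peeled off as well, against the maximality of
    \<open>M\<close>.\<close>
  have len: "2 \<le> length qs"
  proof (rule ccontr)
    assume "\<not> 2 \<le> length qs"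
    then consider "qs = []" | q where "qs = [q]" by (cases qs; cases "tl qs") auto
    then show False
    proof cases
      case 1
      then have "b = unit_path (2 * M)" by (simp add: b_eq unit_path_def)
      then show False using nonunit M1 unfolding b_def is_unit_path_def
        by (metis le_add2 mult_2 le_trans)
    next
      case 2
      then have "is_block q" using blk by simp
      then consider "q = [H]" | s' where "q = U # word s' @ [D]" by (auto simp: is_block_iff)
      then show False
      proof cases
        case 1
        then have "b = unit_path (2 * M + 1)" using 2 by (simp add: b_eq unit_path_def)
        then show False using nonunit unfolding b_def is_unit_path_def
          by (metis le_add2)
      next
        case 2
        then have "b = word (wrap (Suc M) s')" using \<open>qs = [q]\<close>
          by (simp add: b_eq word_wrap replicate_app_Cons_same)
        then have "core_decomp b (Suc M) (tops s')"
          using is_block_tops by (simp only: core_decomp_def word_wrap concat_tops) blast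
        then show False using M_ge[of "Suc M"] by auto
      qed
    qed
  qed
  obtain ts where ts: "qs = map word ts" "\<forall>t\<in>set ts. length (tops t) = 1"
    using blocks_as_words[OF blk] .
  define k where "k = (LEAST t. t < length qs \<and> (\<forall>j<length qs. ht (qs ! j) \<le> ht (qs ! t)))"
  have "\<exists>t. t < length qs \<and> (\<forall>j<length qs. ht (qs ! j) \<le> ht (qs ! t))"
  proof -
    have ne: "ht ` set qs \<noteq> {}" "finite (ht ` set qs)" using len by auto
    then obtain q where q: "q \<in> set qs" "ht q = Max (ht ` set qs)"
      using Max_in[OF ne(2,1)] by (metis imageE)
    then obtain t where "t < length qs" "qs ! t = q" by (auto simp: in_set_conv_nth)
    then show ?thesis using q ne by (intro exI[of _ t]) (auto intro!: Max_ge)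
  qed
  then have k: "k < length qs" "\<forall>j<length qs. ht (qs ! j) \<le> ht (qs ! k)"
    unfolding k_def by (rule LeastI2_ex, simp)+
  have k': "k < length ts" using k(1) ts by simp
  define q where "q = ts ! k"
  have "\<forall>t\<in>set ts. peak t \<le> peak q"
    using k ts(1) by (auto simp: ht_word in_set_conv_nth q_def)
  then have peak: "peak (joins ts) = peak q"
    using k' by (intro peak_joins) (auto simp: q_def)
  define t' where "t' = joins (take k ts @ [wrap M q] @ drop (Suc k) ts)"
  have "lift_highest b = word t'"
    unfolding lift_highest_def M_def[symmetric] the_qs Let_def k_def[symmetric] t'_def
    using k' by (simp add: word_joins word_wrap ts(1) q_def take_map drop_map)
  moreover have "longs t' = longs (Arch s Empty)"
  proof -
    have "word (Arch s Empty) = word (wrap M (joins ts))"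
      using b_eq by (simp add: b_def word_wrap word_joins ts(1))
    then have "longs (Arch s Empty) = longs (wrap M (joins ts))" by (simp only: word_inject)
    \<comment> \<open>\<open>longs q\<close> also occurs in \<open>longs (joins ts)\<close> and
      cancels; what remains on the right belongs to the lifted forest.\<close>
    then have "longs (Arch s Empty) + longs q = longs (wrap M q) + longs (joins ts)"
      using longs_wrap_exchange[OF peak] by simp
    also have "longs (joins ts) = sum_list (map longs (take k ts)) + longs q
        + sum_list (map longs (drop (Suc k) ts))"
      unfolding longs_joins q_def by (rule sum_list_nth_split[OF k'])
    finally show ?thesis by (simp add: t'_def longs_joins ac_simps)
  qed
  moreover have "1 < length (tops t')"
  proof -
    have "tops (wrap M q) \<noteq> []" using M1 by (cases M) auto
    then have "1 \<le> length (tops (wrap M q))" by (simp add: Suc_leI)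
    moreover have "sum_list (map (length \<circ> tops) us) = length us"
      if "set us \<subseteq> set ts" for us
      using that ts(2) by (induction us) auto
    from this[of "take k ts"] this[of "drop (Suc k) ts"]
    have "sum_list (map (length \<circ> tops) (take k ts)) = k"
      "sum_list (map (length \<circ> tops) (drop (Suc k) ts)) = length ts - Suc k"
      using k' set_take_subset[of k ts] set_drop_subset[of "Suc k" ts] by auto
    ultimately show ?thesis using k' len ts(1)
      by (simp only: t'_def length_tops_joins map_append sum_list.append) simp
  qed
  ultimately show ?thesis using that unfolding b_def by blast
qed

lemma shape_step_word:
  assumes "\<not> all_unit (word t)"
  obtains t' where "shape_step (word t) = word t'" "longs t' = longs t"
    "length (tops t) < length (tops t')"
proof -
  obtain ts where ts: "tops t = map word ts" "\<forall>t\<in>set ts. length (tops t) = 1"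
    using blocks_as_words[of "tops t"] is_block_tops by blast
  define i where "i = (LEAST i. i < length (tops t) \<and> \<not> is_unit_path (tops t ! i))"
  have "\<exists>i. i < length (tops t) \<and> \<not> is_unit_path (tops t ! i)"
    using assms by (auto simp: all_unit_def blocks_word in_set_conv_nth)
  then have i: "i < length (tops t)" "\<not> is_unit_path (tops t ! i)"
    unfolding i_def by (rule LeastI2_ex, simp)+
  have i': "i < length ts" using i ts(1) by simp
  have "is_block (tops t ! i)" using i(1) is_block_tops nth_mem by blast
  moreover have "tops t ! i \<noteq> [H]"
    using i(2) by (auto simp: is_unit_path_def unit_path_def intro!: exI[of _ 1])
  ultimately obtain s where s: "tops t ! i = word (Arch s Empty)" by (auto simp: is_block_iff)
  obtain t' where t': "lift_highest (word (Arch s Empty)) = word t'"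
    "longs t' = longs (Arch s Empty)" "1 < length (tops t')"
    using lift_highest_word i(2) s by metis
  have tsi: "ts ! i = Arch s Empty" using s ts(1) i' by (metis nth_map word_inject)
  define t'' where "t'' = joins (take i ts @ [t'] @ drop (Suc i) ts)"
  have t: "t = joins ts" using ts(1) concat_tops[of t] by (simp add: word_inject[symmetric] word_joins)
  have 1: "shape_step (word t) = word t''"
    unfolding shape_step_def blocks_word Let_def i_def[symmetric] s t'(1)
    by (simp add: t''_def word_joins ts(1) take_map drop_map)
  have 2: "longs t'' = longs t"
    unfolding t t''_def longs_joins sum_list_nth_split[OF i', of longs] tsi by (simp add: t'(2) add.assoc)
  have 3: "length (tops t) < length (tops t'')"
    unfolding t t''_def length_tops_joins sum_list_nth_split[OF i', of "length \<circ> tops"] tsi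
    using t'(3) by simp
  show ?thesis using that[of t''] 1 2 3 by blast
qed

text \<open>The loop terminates because each step increases the number of top-level blocks, which is
  bounded by the invariant size of \<open>longs\<close>.\<close>

lemma p_min_word:
  obtains t' where "p_min (word t) = word t'" "longs t' = longs t" "all_unit (word t')"
proof -
  have bound: "length (tops t) \<le> size (longs t)" for t
    by (induction t) auto
  have "\<exists>t'. p_min (word t) = word t' \<and> longs t' = longs t \<and> all_unit (word t')"
  proof (induction "size (longs t) - length (tops t)" arbitrary: t rule: less_induct)
    case less
    show ?case
    proof (cases "all_unit (word t)")
      case True
      then have "p_min (word t) = word t" by (simp add: p_min_def while_unfold)
      then show ?thesis using True by blast
    next
      case False
      obtain t' where t': "shape_step (word t) = word t'" "longs t' = longs t"
        "length (tops t) < length (tops t')"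
        using shape_step_word[OF False] .
      have "p_min (word t) = p_min (word t')"
        using False by (simp add: p_min_def while_unfold[of _ _ "word t"] t'(1))
      moreover have "size (longs t') - length (tops t') < size (longs t) - length (tops t)"
        using t'(2,3) bound[of t'] by simp
      ultimately show ?thesis using less[of t'] t'(2) by simp
    qed
  qed
  then show ?thesis using that by blast
qed

section \<open>Unit paths and the chain lengths of a path\<close>

fun unit_tree :: "nat \<Rightarrow> motz" where
  "unit_tree 0 = Empty"
| "unit_tree (Suc 0) = Flat Empty"
| "unit_tree (Suc (Suc k)) = Arch (unit_tree k) Empty"

text \<open>The contribution of one unit path to \<open>longs\<close>.\<close>

fun chain :: "nat \<Rightarrow> nat multiset" where
  "chain 0 = {#}"
| "chain (Suc 0) = {#1#}"
| "chain (Suc (Suc k)) = add_mset (k + 2) (chain k)"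

lemma unit_path_simps [simp]:
  "unit_path 0 = []" "unit_path (Suc 0) = [H]"
  "unit_path (Suc (Suc k)) = U # unit_path k @ [D]"
  by (simp_all add: unit_path_def replicate_append_same)

lemma length_unit_path [simp]: "length (unit_path k) = k"
  by (induction k rule: unit_tree.induct) auto

lemma word_unit_tree: "word (unit_tree k) = unit_path k"
  by (induction k rule: unit_tree.induct) auto

lemma peak_unit_tree: "peak (unit_tree k) = k"
  by (induction k rule: unit_tree.induct) auto

lemma longs_unit_tree: "longs (unit_tree k) = chain k"
  by (induction k rule: unit_tree.induct) (auto simp: peak_unit_tree)

text \<open>Every entry of a chain lies two below another entry, except the greatest,
  \<open>k\<close>. Differences of counts two apart therefore isolate the chain length.\<close>

lemma count_chain: "0 < j \<Longrightarrow> count (chain k) j = count (chain k) (j + 2) + (if j = k then 1 else 0)"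
  by (induction k rule: chain.induct) auto

text \<open>Up to order, the partition whose conjugate is the shape.\<close>

definition parts :: "path \<Rightarrow> nat list" where
  "parts p = map length (blocks (p_min p))"

text \<open>The algorithm preserves \<open>longs\<close>, and at its end every block is a unit path
  and contributes one chain.\<close>

lemma parts_word: "sum_list (map chain (parts (word t))) = longs t" "0 \<notin> set (parts (word t))"
proof -
  obtain t' where t': "p_min (word t) = word t'" "longs t' = longs t" "all_unit (word t')"
    by (rule p_min_word)
  have len: "parts (word t) = map length (tops t')"
    by (simp add: parts_def t'(1) blocks_word)
  have unit: "\<forall>b\<in>set (tops t'). \<exists>j\<ge>1. b = unit_path j"
    using t'(3) by (simp add: all_unit_def blocks_word is_unit_path_def)
  then show "0 \<notin> set (parts (word t))"
    by (force simp: len)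
  have "tops t' = map unit_path (parts (word t))"
    unfolding len map_map by (rule map_idI[symmetric]) (use unit in fastforce)
  then have "word t' = word (joins (map unit_tree (parts (word t))))"
    using concat_tops[of t'] by (simp add: word_joins comp_def word_unit_tree)
  then have "t' = joins (map unit_tree (parts (word t)))" by (simp only: word_inject)
  then show "sum_list (map chain (parts (word t))) = longs t"
    using t'(2) by (simp add: longs_joins comp_def longs_unit_tree)
qed

text \<open>\<open>count_chain\<close> summed over all parts: the parts, and with them the shape,
  can be read off from \<open>longs\<close>.\<close>

lemma count_parts:
  assumes "0 < j"
  shows "count (longs t) j = count (longs t) (j + 2) + count (mset (parts (word t))) j"
proof -
  have "count (sum_list (map chain ks)) j
      = count (sum_list (map chain ks)) (j + 2) + count (mset ks) j" for ks
    using count_chain[OF assms] by (induction ks) auto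
  from this[of "parts (word t)"] show ?thesis by (simp only: parts_word)
qed

text \<open>Each chain ends in exactly one entry 1 or 2.\<close>

lemma length_parts: "length (parts (word t)) = count (longs t) 1 + count (longs t) 2"
proof -
  have 1: "count (chain k) 1 + count (chain k) 2 = 1" if "0 < k" for k
    using that by (induction k rule: chain.induct) (auto simp: gr0_conv_Suc)
  have "count (sum_list (map chain ks)) 1 + count (sum_list (map chain ks)) 2 = length ks"
    if "0 \<notin> set ks" for ks
    using that
  proof (induction ks)
    case (Cons k ks) then show ?case using 1[of k] by simp
  qed simp
  then show ?thesis using parts_word[of t] by metis
qed

text \<open>A chain of length \<open>k\<close> has \<open>k / 2\<close> entries, rounded up, and
  contains 1 exactly when \<open>k\<close> is odd. The path shows the same balance: an arch has two
  steps for its entry, an H one step for its entry 1.\<close>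

lemma sum_list_parts: "sum_list (parts (word t)) = length (word t)"
proof -
  have chain: "2 * size (chain k) = k + count (chain k) 1" for k
    by (induction k rule: chain.induct) auto
  have "2 * size (sum_list (map chain ks)) = sum_list ks + count (sum_list (map chain ks)) 1" for ks
    by (induction ks) (use chain in auto)
  from this[of "parts (word t)"]
  have "2 * size (longs t) = sum_list (parts (word t)) + count (longs t) 1"
    by (simp only: parts_word)
  moreover have "2 * size (longs t) = length (word t) + count (longs t) 1"
    by (induction t) auto
  ultimately show ?thesis by simp
qed

section \<open>Conjugate partitions\<close>

lemma theta_parts: "theta p = conjugate (rev (sort (parts p)))"
  by (simp add: theta_def parts_def)

text \<open>Double counting of the pairs of an entry \<open>x\<close> and a \<open>j\<close> with
  \<open>r < j\<close> and \<open>j <= x\<close>.\<close>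

lemma sum_list_counts_ge:
  fixes M :: "nat list"
  assumes "\<forall>x\<in>set M. r < x \<and> x < b"
  shows "sum_list (map (\<lambda>j. length (filter (\<lambda>x. j \<le> x) M)) [Suc r..<b]) + r * length M = sum_list M"
  using assms
proof (induction M)
  case Nil
  then show ?case by simp
next
  case (Cons x M)
  have "sum_list (map (\<lambda>j. if j \<le> x then 1 else 0) [Suc r..<b])
      = (\<Sum>j\<in>{Suc r..<b}. if j \<le> x then 1 else 0)"
    by (simp add: interv_sum_list_conv_sum_set_nat)
  also have "\<dots> = card ({Suc r..<b} \<inter> {j. j \<le> x})"
    by (simp add: sum.If_cases)
  also have "{Suc r..<b} \<inter> {j. j \<le> x} = {Suc r..x}" using Cons.prems by auto
  finally have 1: "sum_list (map (\<lambda>j. if j \<le> x then 1 else 0) [Suc r..<b]) = x - r" by simp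
  have "map (\<lambda>j. length (filter (\<lambda>y. j \<le> y) (x # M))) [Suc r..<b]
      = map (\<lambda>j. (if j \<le> x then 1 else 0) + length (filter (\<lambda>y. j \<le> y) M)) [Suc r..<b]"
    by simp
  then have "sum_list (map (\<lambda>j. length (filter (\<lambda>y. j \<le> y) (x # M))) [Suc r..<b])
      = (x - r) + sum_list (map (\<lambda>j. length (filter (\<lambda>y. j \<le> y) M)) [Suc r..<b])"
    by (simp only: sum_list_addf 1)
  then show ?case using Cons by simp
qed

text \<open>\<open>M\<close> lists, in any order, the parts of the partition with conjugate
  \<open>lam\<close>. The bound \<open>last\<close> is stated through a second conjugation; the
  facts below translate it back to \<open>M\<close>.\<close>

context
  fixes M lam :: "nat list" and r :: nat
  assumes lam: "lam = conjugate (rev (sort M))" and ne: "lam \<noteq> []" and pos: "0 \<notin> set M"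
    and last: "r < conjugate lam ! (lam ! 0 - 1)"
begin

private definition mu where "mu = rev (sort M)"
private definition h where "h = hd mu"

private lemma set_mu: "set mu = set M" and length_mu: "length mu = length M"
  by (simp_all add: mu_def)

private lemma mu_ne: "mu \<noteq> []"
  using ne lam by (auto simp: conjugate_def mu_def)

private lemma le_h: "x \<in> set M \<Longrightarrow> x \<le> h"
proof -
  obtain ys where mu: "mu = h # ys" using mu_ne by (metis h_def list.collapse)
  have "sorted (rev mu)" by (simp add: mu_def)
  then have "sorted (rev ys @ [h])" unfolding mu by simp
  then have "\<forall>x\<in>set (h # ys). x \<le> h" by (simp add: sorted_append)
  then show "x \<in> set M \<Longrightarrow> x \<le> h" unfolding set_mu[symmetric] mu by blast
qed

private lemma h_in: "h \<in> set M"
  unfolding h_def set_mu[symmetric] by (rule hd_in_set[OF mu_ne])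

private lemma lam_eq: "lam = map (\<lambda>j. length (filter (\<lambda>x. j \<le> x) mu)) [1..<Suc h]"
  using lam mu_ne by (simp add: conjugate_def mu_def[symmetric] h_def)

private lemma lam_0: "lam ! 0 = length M"
proof -
  have "0 < h" using h_in pos by (metis gr0I)
  moreover have "filter (\<lambda>x. 1 \<le> x) mu = mu"
    using pos set_mu by (auto simp: filter_id_conv Suc_le_eq intro: gr0I)
  ultimately show ?thesis by (simp add: lam_eq length_mu del: upt_Suc)
qed

text \<open>\<open>lam ! 0\<close> is the number of parts, so the last entry of
  \<open>conjugate lam\<close> counts the positive \<open>j\<close> that are at most every part.
  Hence it is at most \<open>x\<close>.\<close>

lemma all_parts_gt: "x \<in> set M \<Longrightarrow> r < x"
proof (rule ccontr)
  assume x: "x \<in> set M" and "\<not> r < x"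
  let ?L = "length M"
  have L: "0 < ?L" using mu_ne length_mu by auto
  have "conjugate lam ! (lam ! 0 - 1) = length (filter (\<lambda>y. ?L \<le> y) lam)"
    using ne L lam_0 by (simp add: conjugate_def hd_conv_nth del: upt_Suc)
  also have "\<dots> = length (filter (\<lambda>j. ?L \<le> length (filter (\<lambda>x. j \<le> x) mu)) [1..<Suc h])"
    unfolding lam_eq by (simp add: filter_map comp_def del: upt_Suc)
  also have "\<dots> = card {j \<in> {1..<Suc h}. ?L \<le> length (filter (\<lambda>x. j \<le> x) mu)}"
    by (subst distinct_card[symmetric]) (auto simp del: upt_Suc)
  also have "\<dots> \<le> card {1..x}"
  proof (rule card_mono)
    show "{j \<in> {1..<Suc h}. ?L \<le> length (filter (\<lambda>x. j \<le> x) mu)} \<subseteq> {1..x}"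
    proof safe
      fix j assume j: "j \<in> {1..<Suc h}" "?L \<le> length (filter (\<lambda>x. j \<le> x) mu)"
      then have "filter (\<lambda>x. j \<le> x) mu = mu"
        by (metis length_filter_le length_mu le_antisym length_filter_less not_less filter_id_conv)
      then have "j \<le> x" using x set_mu by (metis filter_id_conv)
      then show "j \<in> {1..x}" using j by simp
    qed
  qed simp
  finally show False using last \<open>\<not> r < x\<close> by simp
qed

text \<open>With the parts as rows, the entries of \<open>lam\<close> from index \<open>r\<close> on
  count the cells beyond the first \<open>r\<close> columns, and every part fills those
  columns.\<close>

lemma sum_drop_conjugate: "sum_list (drop r lam) + r * length M = sum_list M"
proof -
  have "drop r lam = map (\<lambda>j. length (filter (\<lambda>x. j \<le> x) mu)) [Suc r..<Suc h]"
    by (simp add: lam_eq drop_map drop_upt del: upt_Suc)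
  moreover have "\<forall>x\<in>set mu. r < x \<and> x < Suc h"
    using all_parts_gt le_h set_mu by (auto simp: less_Suc_eq_le)
  moreover have "sum_list mu = sum_list M"
    by (metis mu_def mset_rev mset_sort sum_mset_sum_list)
  ultimately show ?thesis using sum_list_counts_ge[of mu r "Suc h"] length_mu by simp
qed

text \<open>The new parts are smaller than all others, so sorting puts them last; each adds one to
  the first \<open>r\<close> column lengths, and the largest part stays the same.\<close>

lemma conjugate_add_parts:
  assumes "mset M' = mset M + replicate_mset m r"
  shows "conjugate (rev (sort M')) = map (\<lambda>x. x + m) (take r lam) @ drop r lam"
proof -
  have "sort M' = replicate m r @ sort M"
  proof (rule properties_for_sort)
    show "mset (replicate m r @ sort M) = mset M'" using assms by simp
    show "sorted (replicate m r @ sort M)"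
      using all_parts_gt by (auto simp: sorted_append less_imp_le)
  qed
  then have M': "rev (sort M') = mu @ replicate m r" by (simp add: mu_def)
  have h: "r < h" using all_parts_gt h_in by simp
  then have upt: "[1..<Suc h] = [1..<Suc r] @ [Suc r..<Suc h]"
    using upt_add_eq_append[of 1 "Suc r" "h - r"] by simp
  have "conjugate (rev (sort M'))
      = map (\<lambda>j. length (filter (\<lambda>x. j \<le> x) mu) + (if j \<le> r then m else 0)) [1..<Suc h]"
    using mu_ne by (simp add: M' conjugate_def h_def filter_replicate del: upt_Suc)
  also have "\<dots> = map (\<lambda>x. x + m) (take r lam) @ drop r lam"
    unfolding lam_eq take_map drop_map upt map_append map_map
    by (simp del: upt_Suc)
  finally show ?thesis .
qed

end

section \<open>Inserting a tree\<close>

text \<open>The point just before a closing D still counts as inside the arch. Beyond the end of the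
  word the value is a default; see \<open>word_ins\<close>.\<close>

fun ins :: "motz \<Rightarrow> nat \<Rightarrow> motz \<Rightarrow> motz" where
  "ins u 0 t = join u t"
| "ins u (Suc x) Empty = u"
| "ins u (Suc x) (Flat t) = Flat (ins u x t)"
| "ins u (Suc x) (Arch s t) = (if x \<le> length (word s) then Arch (ins u x s) t
     else Arch s (ins u (x - Suc (length (word s))) t))"

text \<open>The condition under which inserting a tree of peak \<open>r\<close> at abscissa
  \<open>x\<close> raises none of the enclosing arches.\<close>

fun roomy :: "nat \<Rightarrow> nat \<Rightarrow> motz \<Rightarrow> bool" where
  "roomy r 0 t = True"
| "roomy r (Suc x) Empty = False"
| "roomy r (Suc x) (Flat t) = roomy r x t"
| "roomy r (Suc x) (Arch s t) = (if x \<le> length (word s) then r \<le> peak s \<and> roomy r x s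
     else roomy r (x - Suc (length (word s))) t)"

lemma word_ins:
  "x \<le> length (word t) \<Longrightarrow> word (ins u x t) = take x (word t) @ word u @ drop x (word t)"
proof (induction u x t rule: ins.induct)
  case (4 u x s t)
  show ?case
  proof (cases "x \<le> length (word s)")
    case True then show ?thesis using 4 by simp
  next
    case False
    then obtain k where k: "x = length (word s) + Suc k"
      using less_imp_Suc_add[of "length (word s)" x] by auto
    then show ?thesis using 4 by simp
  qed
qed auto

text \<open>No enclosing arch changes its weighted height, so only the subblocks of \<open>u\<close>
  are new.\<close>

lemma roomy_ins:
  "roomy (peak u) x t \<Longrightarrow>
    peak (ins u x t) = max (peak u) (peak t) \<and> longs (ins u x t) = longs u + longs t"
  by (induction u x t rule: ins.induct) (auto split: if_splits simp: max_def)

lemma peak_le_ins: "peak t \<le> peak (ins u x t)"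
  by (induction u x t rule: ins.induct) auto

text \<open>Insertions proceed from right to left. One at or to the right of \<open>x\<close> leaves
  \<open>x\<close> in place and can only raise peaks.\<close>

lemma roomy_ins_mono: "x \<le> y \<Longrightarrow> roomy r x t \<Longrightarrow> roomy r x (ins u y t)"
proof (induction u y t arbitrary: x rule: ins.induct)
  case (3 u y t) then show ?case by (cases x) auto
next
  case (4 u y s t)
  show ?case
  proof (cases x)
    case (Suc z)
    show ?thesis
    proof (cases "y \<le> length (word s)")
      case True
      then show ?thesis using 4 Suc peak_le_ins[of s u y] by (auto simp: word_ins)
    next
      case False
      then show ?thesis using 4 Suc by (auto split: if_splits)
    qed
  qed simp
next
  case (2 u y) then show ?case by (cases x) auto
qed simp

text \<open>Each subblock of weighted height \<open>j + 2\<close> has a child of weighted height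
  \<open>j\<close>, different for different parents. A highest top-level block is no such
  child.\<close>

lemma count_longs_ge:
  "0 < j \<Longrightarrow> count (longs t) (j + 2) + (if peak t = j then 1 else 0) \<le> count (longs t) j"
  by (induction t) (auto simp: max_def)

text \<open>The surplus of the count at \<open>j\<close> over the count at \<open>j + 2\<close> is the number of chains of length \<open>j\<close>.
  In an exact tree no chain has length at most \<open>r\<close>; in a tight one only the chain of a highest
  top-level block may, and inside an enclosing \<open>U\<close>, \<open>D\<close> that chain goes on.\<close>

definition exact :: "nat \<Rightarrow> motz \<Rightarrow> bool" where
  "exact r t \<longleftrightarrow> (\<forall>j. 0 < j \<and> j \<le> r \<longrightarrow> count (longs t) j = count (longs t) (j + 2))"

definition tight :: "nat \<Rightarrow> motz \<Rightarrow> bool" where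
  "tight r t \<longleftrightarrow> (\<forall>j. 0 < j \<and> j \<le> r \<longrightarrow>
     count (longs t) j = count (longs t) (j + 2) + (if peak t = j then 1 else 0))"

text \<open>By \<open>count_longs_ge\<close>, exactness rules out that \<open>peak t\<close> is one
  of these \<open>j\<close>.\<close>

lemma exact_imp_tight:
  assumes "exact r t"
  shows "tight r t"
  unfolding tight_def
proof (intro allI impI)
  fix j assume "0 < j \<and> j \<le> r"
  then show "count (longs t) j = count (longs t) (j + 2) + (if peak t = j then 1 else 0)"
    using assms count_longs_ge[of j t] unfolding exact_def by (metis le_add1 le_antisym)
qed

lemma tight_imp_exact:
  assumes "tight r t" "r < peak t"
  shows "exact r t"
  unfolding exact_def
proof (intro allI impI)
  fix j assume j: "0 < j \<and> j \<le> r"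
  then have "peak t \<noteq> j" using assms(2) by simp
  then show "count (longs t) j = count (longs t) (j + 2)"
    using assms(1) j unfolding tight_def by (metis add.right_neutral)
qed

text \<open>A top-level block always starts a chain, here one of length 1.\<close>

lemma not_exact_Flat:
  assumes "0 < r"
  shows "\<not> exact r (Flat t)"
proof
  assume "exact r (Flat t)"
  then have "count (longs (Flat t)) 1 = count (longs (Flat t)) (1 + 2)"
    using assms unfolding exact_def by (metis One_nat_def Suc_leI zero_less_one)
  then show False using count_longs_ge[of 1 t] by (simp split: if_splits)
qed

text \<open>The surplus at \<open>j\<close> is a sum of three nonnegative terms: one for the arch as
  the start of a chain, the surplus of \<open>s\<close> less that of its highest block, which the
  arch absorbs, and the surplus of \<open>t\<close>. All three vanish.\<close>

lemma exact_Arch: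
  assumes "exact r (Arch s t)"
  shows "r < 2 + peak s" "tight r s" "exact r t"
proof -
  have *: "j \<noteq> 2 + peak s \<and> count (longs s) j = count (longs s) (j + 2) + (if peak s = j then 1 else 0)
      \<and> count (longs t) j = count (longs t) (j + 2)" if "0 < j" "j \<le> r" for j
  proof -
    have "count (longs (Arch s t)) j = count (longs (Arch s t)) (j + 2)"
      using assms that by (simp add: exact_def)
    then show ?thesis
      using count_longs_ge[OF that(1), of s] count_longs_ge[OF that(1), of t]
      by (auto split: if_splits)
  qed
  show "r < 2 + peak s" using *[of "2 + peak s"] by force
  show "tight r s" "exact r t" using * by (auto simp: tight_def exact_def)
qed

text \<open>The surpluses of \<open>s\<close> and \<open>t\<close> are bounded below by
  \<open>count_longs_ge\<close>, and the surplus allowed to the whole leaves no slack in either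
  bound.\<close>

lemma tight_Arch:
  assumes "tight r (Arch s t)"
  shows "tight r s" "tight r t"
proof -
  have "count (longs s) j = count (longs s) (j + 2) + (if peak s = j then 1 else 0)
      \<and> count (longs t) j = count (longs t) (j + 2) + (if peak t = j then 1 else 0)"
    if "0 < j" "j \<le> r" for j
  proof -
    have "count (longs (Arch s t)) j
        = count (longs (Arch s t)) (j + 2) + (if peak (Arch s t) = j then 1 else 0)"
      using assms that by (simp add: tight_def)
    then show ?thesis
      using count_longs_ge[OF that(1), of s] count_longs_ge[OF that(1), of t]
      by (auto split: if_splits simp: max_def)
  qed
  then show "tight r s" "tight r t" by (auto simp: tight_def)
qed

lemma tight_Flat:
  assumes "tight r (Flat t)"
  shows "tight r t"
proof -
  have "count (longs t) j = count (longs t) (j + 2) + (if peak t = j then 1 else 0)"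
    if "0 < j" "j \<le> r" for j
  proof -
    have "count (longs (Flat t)) j
        = count (longs (Flat t)) (j + 2) + (if peak (Flat t) = j then 1 else 0)"
      using assms that by (simp add: tight_def)
    then show ?thesis using count_longs_ge[OF that(1), of t]
      by (auto split: if_splits simp: max_def)
  qed
  then show ?thesis by (auto simp: tight_def)
qed

text \<open>A second top-level block would start a second chain of length at most \<open>r\<close>,
  so the tree is a single chain.\<close>

lemma tight_unit: "tight r t \<Longrightarrow> peak t \<le> r \<Longrightarrow> t = unit_tree (peak t)"
proof (induction t)
  case (Flat t)
  have "t = Empty"
  proof (rule ccontr)
    assume "t \<noteq> Empty"
    then have "0 < peak t" by (metis gr0I peak_eq_0_iff)
    have "count (longs (Flat t)) 1 = count (longs (Flat t)) (1 + 2) + (if peak (Flat t) = 1 then 1 else 0)"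
      using Flat.prems unfolding tight_def
      by (metis max.cobounded1 order_trans peak.simps(2) zero_less_one)
    then show False using count_longs_ge[of 1 t] \<open>0 < peak t\<close> by (auto split: if_splits)
  qed
  then show ?case by simp
next
  case (Arch s t)
  have "t = Empty"
  proof (rule ccontr)
    assume "t \<noteq> Empty"
    then have pos: "0 < peak t" by (metis gr0I peak_eq_0_iff)
    \<comment> \<open>At the lower of the two peaks both counts are known: if the peaks differ, no
      surplus is allowed there; if they agree, only one is, but there are two.\<close>
    define j where "j = min (2 + peak s) (peak t)"
    have j: "0 < j" "j \<le> r" using pos Arch.prems(2) by (auto simp: j_def)
    then have "count (longs (Arch s t)) j
        = count (longs (Arch s t)) (j + 2) + (if peak (Arch s t) = j then 1 else 0)"
      using Arch.prems(1) by (simp add: tight_def)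
    then show False
      using count_longs_ge[OF j(1), of s] count_longs_ge[OF j(1), of t]
      by (auto split: if_splits simp: max_def min_def j_def)
  qed
  moreover have "s = unit_tree (peak s)"
    using Arch.IH(1) tight_Arch[OF Arch.prems(1)] Arch.prems(2) by simp
  ultimately show ?case by (metis add_2_eq_Suc max_0R peak.simps(1,3) unit_tree.simps(3))
qed simp

text \<open>Take the outermost arch around \<open>x\<close> whose content has peak
  \<open>k < r\<close>. By \<open>tight_unit\<close> that content is a unit path, hence so is the
  arch.\<close>

lemma tight_not_roomy:
  assumes "tight r t" "\<not> roomy r x t" "x \<le> length (word t)"
  shows "\<exists>a k b. word t = a @ unit_path (k + 2) @ b \<and> k < r \<and> length a < x \<and> x \<le> length a + 1 + k"
  using assms
proof (induction t arbitrary: x)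
  case Empty then show ?case by (cases x) auto
next
  case (Flat t)
  then obtain y where y: "x = Suc y" by (cases x) auto
  obtain a k b where "word t = a @ unit_path (k + 2) @ b \<and> k < r \<and> length a < y \<and> y \<le> length a + 1 + k"
    using Flat.IH[of y] Flat.prems tight_Flat y by auto
  then show ?case by (intro exI[of _ "H # a"] exI[of _ k] exI[of _ b]) (auto simp: y)
next
  case (Arch s t)
  then obtain y where y: "x = Suc y" by (cases x) auto
  note ti = tight_Arch[OF Arch.prems(1)]
  show ?case
  proof (cases "y \<le> length (word s)")
    case True
    show ?thesis
    proof (cases "peak s < r")
      case True
      then have "s = unit_tree (peak s)" using tight_unit ti by simp
      then have s: "word s = unit_path (peak s)" by (metis word_unit_tree)
      then show ?thesis using True \<open>y \<le> length (word s)\<close> y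
        by (intro exI[of _ "[]"] exI[of _ "peak s"] exI[of _ "word t"]) auto
    next
      case False
      then have "\<not> roomy r y s" using Arch.prems(2) True y by simp
      then obtain a k b where "word s = a @ unit_path (k + 2) @ b \<and> k < r \<and> length a < y \<and> y \<le> length a + 1 + k"
        using Arch.IH(1)[of y] ti True by auto
      then show ?thesis
        by (intro exI[of _ "U # a"] exI[of _ k] exI[of _ "b @ D # word t"]) (auto simp: y)
    qed
  next
    case False
    then obtain z where z: "y = length (word s) + Suc z"
      using less_imp_Suc_add[of "length (word s)" y] by auto
    then have "\<not> roomy r z t" using Arch.prems(2) y by simp
    then obtain a k b where "word t = a @ unit_path (k + 2) @ b \<and> k < r \<and> length a < z \<and> z \<le> length a + 1 + k"
      using Arch.IH(2)[of z] ti Arch.prems(3) z y by auto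
    then show ?thesis
      by (intro exI[of _ "U # word s @ D # a"] exI[of _ k] exI[of _ b]) (auto simp: y z)
  qed
qed

section \<open>Keys: the centres of unit paths\<close>

definition is_key :: "path \<Rightarrow> nat \<Rightarrow> bool" where
  "is_key p j \<longleftrightarrow> j < length p \<and> (p ! j = H \<or> (0 < j \<and> p ! (j - 1) = U \<and> p ! j = D))"

lemma nth_unit_path:
  "j < k \<Longrightarrow> unit_path k ! j = (if j < k div 2 then U else if odd k \<and> j = k div 2 then H else D)"
  by (auto simp: unit_path_def nth_append)

lemma is_key_unit_path: "is_key (unit_path k) j \<longleftrightarrow> 0 < k \<and> j = k div 2"
proof
  assume k: "is_key (unit_path k) j"
  then have "j < k" by (simp add: is_key_def)
  then show "0 < k \<and> j = k div 2"
    using k by (auto simp: is_key_def nth_unit_path split: if_splits)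
next
  assume "0 < k \<and> j = k div 2"
  moreover have "k div 2 < k" "k div 2 - 1 < k" if "0 < k" using that by auto
  moreover have "1 < k" if "0 < k" "even k" using that by (cases "k = 1") auto
  ultimately show "is_key (unit_path k) j" by (auto simp: is_key_def nth_unit_path)
qed

lemma unit_segment_append:
  "unit_segment q (i, k) \<Longrightarrow> unit_segment (a @ q @ b) (length a + i, k)"
  by (auto simp: unit_segment_def)

lemma unit_segment_unit_path: "0 < k \<Longrightarrow> unit_segment (unit_path k) (0, k)"
  by (auto simp: unit_segment_def is_unit_path_def intro!: exI[of _ k])

lemma hd_word: "word t \<noteq> [] \<Longrightarrow> hd (word t) \<noteq> D"
  by (cases t) auto

lemma last_word: "word t \<noteq> [] \<Longrightarrow> last (word t) \<noteq> U"
  by (induction t) auto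

text \<open>Descend towards the key. As long as the content of an arch has peak above
  \<open>r\<close>, it is exact again; otherwise it is a unit path, and the arch around it is one of
  length above \<open>r\<close>.\<close>

lemma exact_key_segment:
  assumes "exact r t" "0 < r" "is_key (word t) j"
  shows "\<exists>i k. unit_segment (word t) (i, k) \<and> i + k div 2 = j \<and> r < k"
  using assms(1,3)
proof (induction t arbitrary: j)
  case Empty then show ?case by (simp add: is_key_def)
next
  case (Flat t) then show ?case using not_exact_Flat assms(2) by simp
next
  case (Arch s t)
  note ex = exact_Arch[OF Arch.prems(1)]
  consider "j = 0" | i where "j = Suc i" "i < length (word s)" | "j = Suc (length (word s))"
    | k where "j = Suc (length (word s) + Suc k)"
    by (metis add_Suc_right less_imp_Suc_add linorder_neqE_nat not0_implies_Suc)
  then show ?case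
  proof cases
    case 1 then show ?thesis using Arch.prems(2) by (simp add: is_key_def)
  next
    case 2
    \<comment> \<open>The U of the arch therefore creates no key at the first point of
      \<open>s\<close>.\<close>
    have "word s ! 0 \<noteq> D" using 2 hd_word[of s] by (cases "word s") auto
    then have key: "is_key (word s) i"
      using Arch.prems(2) 2 by (cases i) (auto simp: is_key_def nth_append)
    show ?thesis
    proof (cases "r < peak s")
      case True
      obtain i' k where "unit_segment (word s) (i', k)" "i' + k div 2 = i" "r < k"
        using Arch.IH(1)[OF tight_imp_exact[OF ex(2) True] key] by blast
      then show ?thesis using unit_segment_append[of "word s" i' k "[U]" "D # word t"] 2(1)
        by (intro exI[of _ "Suc i'"] exI[of _ k]) simp
    next
      case False
      then have "s = unit_tree (peak s)" using tight_unit ex by simp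
      then have s: "word s = unit_path (peak s)" by (metis word_unit_tree)
      then have i: "i = peak s div 2" using key by (simp add: is_key_unit_path)
      have "unit_segment (word (Arch s t)) (0, peak s + 2)"
        using unit_segment_append[OF unit_segment_unit_path[of "peak s + 2"], of "[]" "word t"] s by simp
      then show ?thesis using i 2(1) ex(1)
        by (intro exI[of _ 0] exI[of _ "peak s + 2"]) simp
    qed
  next
    case 3
    \<comment> \<open>A key at the closing D needs a U just before it, but a nonempty word does not
      end in U.\<close>
    have "s = Empty"
    proof (rule ccontr)
      assume "s \<noteq> Empty"
      then have ne: "word s \<noteq> []" by (cases s) auto
      then have "(U # word s) ! length (word s) = last (word s)"
        by (cases "word s" rule: rev_cases) auto
      then have "last (word s) = U" using Arch.prems(2) 3 ne
        by (auto simp: is_key_def nth_append nth_Cons split: nat.splits if_splits)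
      then show False using last_word ne by blast
    qed
    then have "unit_segment (word (Arch s t)) (0, 2)"
      using unit_segment_append[OF unit_segment_unit_path[of 2], of "[]" "word t"]
      by (simp add: numeral_2_eq_2)
    then show ?thesis using 3 ex(1) \<open>s = Empty\<close> by (intro exI[of _ 0] exI[of _ 2]) simp
  next
    case 4
    then have "k < length (word t)" using Arch.prems(2) by (simp add: is_key_def)
    then have "word t ! 0 \<noteq> D" using hd_word[of t] by (cases "word t") auto
    then have "is_key (word t) k"
      using Arch.prems(2) 4 by (cases k) (auto simp: is_key_def nth_append)
    then obtain i' k' where "unit_segment (word t) (i', k')" "i' + k' div 2 = k" "r < k'"
      using Arch.IH(2)[OF ex(3)] by blast
    then show ?thesis using unit_segment_append[of "word t" i' k' "U # word s @ [D]" "[]"] 4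
      by (intro exI[of _ "Suc (Suc (length (word s))) + i'"] exI[of _ k']) simp
  qed
qed

section \<open>Unital segments and marks\<close>

lemma unit_segment_iff:
  "unit_segment p (i, k) \<longleftrightarrow> 0 < k \<and> i + k \<le> length p \<and> (\<forall>j<k. p ! (i + j) = unit_path k ! j)"
proof -
  have "is_unit_path (take k (drop i p)) \<longleftrightarrow> 0 < k \<and> take k (drop i p) = unit_path k"
    if "i + k \<le> length p"
  proof -
    have len: "length (take k (drop i p)) = k" using that by simp
    show ?thesis unfolding is_unit_path_def
      by (metis One_nat_def Suc_le_eq len length_unit_path)
  qed
  moreover have "take k (drop i p) = unit_path k \<longleftrightarrow> (\<forall>j<k. p ! (i + j) = unit_path k ! j)"
    if "i + k \<le> length p"
    using that by (auto simp: list_eq_iff_nth_eq)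
  ultimately show ?thesis by (auto simp: unit_segment_def)
qed

lemma unit_segment_nth:
  assumes "unit_segment p (i, k)" "i \<le> x" "x < i + k"
  shows "p ! x = (if x < i + k div 2 then U else if odd k \<and> x = i + k div 2 then H else D)"
proof -
  obtain j where "x = i + j" "j < k" using assms(2,3) le_Suc_ex by fastforce
  then show ?thesis using assms(1) by (auto simp: unit_segment_iff nth_unit_path)
qed

lemma unit_segment_pos: "unit_segment p (i, k) \<Longrightarrow> 0 < k \<and> i + k \<le> length p \<and> k div 2 < k"
  by (simp add: unit_segment_iff)

lemma unit_segment_key:
  assumes "unit_segment p (i, k)"
  shows "is_key p (i + k div 2)" "odd k \<longleftrightarrow> p ! (i + k div 2) = H"
proof -
  note pos = unit_segment_pos[OF assms]
  have 1: "p ! (i + k div 2) = (if odd k then H else D)"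
    using unit_segment_nth[OF assms, of "i + k div 2"] pos by simp
  then show "odd k \<longleftrightarrow> p ! (i + k div 2) = H" by simp
  have "p ! (i + k div 2 - 1) = U \<and> 0 < i + k div 2" if "even k"
  proof -
    have "0 < k div 2" using that pos by (auto elim!: evenE)
    then show ?thesis using unit_segment_nth[OF assms, of "i + k div 2 - 1"] pos by auto
  qed
  then show "is_key p (i + k div 2)" using 1 pos by (auto simp: is_key_def)
qed

lemma unit_segment_key_unique:
  assumes "unit_segment p (i, k)" "i \<le> j" "j < i + k" "is_key p j"
  shows "j = i + k div 2"
proof (rule ccontr)
  assume ne: "j \<noteq> i + k div 2"
  have nth: "p ! j = (if j < i + k div 2 then U else if odd k \<and> j = i + k div 2 then H else D)"
    using unit_segment_nth[OF assms(1-3)] .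
  then have D: "p ! j = D" "i + k div 2 < j" "p ! (j - 1) = U"
    using assms(4) ne by (auto simp: is_key_def split: if_splits)
  then have "i \<le> j - 1" "j - 1 < i + k" "\<not> j - 1 < i + k div 2" using assms(3) by auto
  then show False using unit_segment_nth[OF assms(1), of "j - 1"] D(3) by (auto split: if_splits)
qed

text \<open>The step at the common centre fixes the parity, so the two segments are
  concentric.\<close>

lemma unit_segment_nested:
  assumes "unit_segment p (i, k)" "unit_segment p (i', k')" "i + k div 2 = i' + k' div 2" "k \<le> k'"
  shows "i' \<le> i \<and> i + k \<le> i' + k'" "even (k' - k)"
proof -
  have "odd k \<longleftrightarrow> odd k'" using unit_segment_key(2) assms(1,2,3) by metis
  then show "i' \<le> i \<and> i + k \<le> i' + k'" "even (k' - k)"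
    using assms(3,4) by (auto elim!: evenE oddE)
qed

lemma unital_max:
  assumes "(i, k) \<in> unital_segments p" "unit_segment p (i', k')" "i + k div 2 = i' + k' div 2"
  shows "k' \<le> k"
proof (rule ccontr)
  assume "\<not> k' \<le> k"
  moreover have "unit_segment p (i, k)" using assms(1) by (simp add: unital_segments_def)
  ultimately have "i' \<le> i \<and> i + k \<le> i' + k'" using unit_segment_nested[of p i k i' k'] assms by simp
  then have "(i', k') = (i, k)" using assms(1,2) unfolding unital_segments_def by blast
  then show False using \<open>\<not> k' \<le> k\<close> by simp
qed

text \<open>The longest unit segment with a given centre is maximal under inclusion: any segment
  containing it has the same centre, because a unit path contains only one key.\<close>

lemma unital_exists:
  assumes "unit_segment p (i, k)"
  obtains i' k' where "(i', k') \<in> unital_segments p" "i' + k' div 2 = i + k div 2" "k \<le> k'"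
    "i' \<le> i" "i + k \<le> i' + k'" "even (k' - k)"
proof -
  define P where "P k' \<longleftrightarrow> (\<exists>i'. unit_segment p (i', k') \<and> i' + k' div 2 = i + k div 2)" for k'
  have P: "P k" using assms by (auto simp: P_def)
  have bound: "\<forall>y. P y \<longrightarrow> y \<le> length p" by (auto simp: P_def unit_segment_iff)
  define k' where "k' = Greatest P"
  have "P k'" unfolding k'_def by (rule GreatestI_nat[where P = P, OF P]) (use bound in blast)
  then obtain i' where i': "unit_segment p (i', k')" "i' + k' div 2 = i + k div 2"
    by (auto simp: P_def)
  have max: "y \<le> k'" if "P y" for y
    unfolding k'_def by (rule Greatest_le_nat[where P = P, OF that]) (use bound in blast)
  have "(i'', k'') = (i', k')"
    if "unit_segment p (i'', k'') \<and> i'' \<le> i' \<and> i' + k' \<le> i'' + k''" for i'' k''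
  proof -
    have "i' + k' div 2 = i'' + k'' div 2"
      using that unit_segment_key(1)[OF i'(1)] unit_segment_pos[OF i'(1)]
      by (intro unit_segment_key_unique) auto
    then have "k'' \<le> k'" using that i'(2) max by (auto simp: P_def)
    then show ?thesis using that by auto
  qed
  then have "(i', k') \<in> unital_segments p" using i'(1) by (auto simp: unital_segments_def)
  then show ?thesis
    using that[of i' k'] i' max[OF P] unit_segment_nested[OF assms i'(1) i'(2)[symmetric]] by simp
qed

lemma key_segment:
  assumes "is_key p j"
  shows "\<exists>i k. unit_segment p (i, k) \<and> i + k div 2 = j"
proof (cases "p ! j = H")
  case True
  then show ?thesis using assms
    by (intro exI[of _ j] exI[of _ 1]) (auto simp: unit_segment_iff is_key_def)
next
  case False
  then have j: "0 < j" "p ! (j - 1) = U" "p ! j = D" "j < length p"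
    using assms by (auto simp: is_key_def)
  have "p ! (j - 1 + i) = unit_path 2 ! i" if "i < 2" for i
    using that j by (cases "i = 0") (auto simp: nth_unit_path less_2_cases_iff)
  then have "unit_segment p (j - 1, 2)" using j by (simp add: unit_segment_iff)
  then show ?thesis using j by (intro exI[of _ "j - 1"] exI[of _ 2]) simp
qed

text \<open>This reduces counting unital segments to counting keys, which is a local matter.\<close>

lemma bij_betw_unital_key:
  "bij_betw (\<lambda>(i, k). i + k div 2) (unital_segments p) {j. is_key p j}"
  unfolding bij_betw_def
proof
  show "inj_on (\<lambda>(i, k). i + k div 2) (unital_segments p)"
  proof (rule inj_onI, clarify)
    fix i k i' k' assume *: "(i, k) \<in> unital_segments p" "(i', k') \<in> unital_segments p"
      "i + k div 2 = i' + k' div 2"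
    then have "unit_segment p (i, k)" "unit_segment p (i', k')" by (auto simp: unital_segments_def)
    then have "k' \<le> k" "k \<le> k'" using unital_max *(1,2) *(3) *(3)[symmetric] by blast+
    then show "i = i' \<and> k = k'" using *(3) by simp
  qed
  have "j \<in> (\<lambda>(i, k). i + k div 2) ` unital_segments p" if j: "is_key p j" for j
  proof -
    obtain i k where "unit_segment p (i, k)" "i + k div 2 = j" using key_segment[OF j] by blast
    then obtain i' k' where "(i', k') \<in> unital_segments p" "i' + k' div 2 = j"
      using unital_exists by metis
    then show ?thesis by force
  qed
  then show "(\<lambda>(i, k). i + k div 2) ` unital_segments p = {j. is_key p j}"
    using unit_segment_key(1) by (auto simp: unital_segments_def)
qed

text \<open>Used in both directions: unit segments that share a step have the same centre.\<close>

lemma unit_segments_overlap: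
  assumes s: "unit_segment p (i, k)" "unit_segment p (i', k')"
    and x: "i \<le> x" "x < i + k" "i' \<le> x" "x < i' + k'"
  shows "i' + k' div 2 \<le> i + k div 2"
proof (rule ccontr)
  define c c' where "c = i + k div 2" and "c' = i' + k' div 2"
  assume "\<not> i' + k' div 2 \<le> i + k div 2"
  then have less: "c < c'" by (simp add: c_def c'_def)
  note pos = unit_segment_pos[OF s(1)] unit_segment_pos[OF s(2)]
  \<comment> \<open>A common step at or after the first centre and not after the second: the first
    segment reads H or D there, the second U unless \<open>y = c'\<close>. So the second consists of
    a single H, which the first allows only at \<open>c\<close>.\<close>
  define y where "y = max i' c"
  have y: "c \<le> y" "i' \<le> y" "y \<le> c'" "y < i + k" "y < i' + k'" "i \<le> y"
    using less x pos by (auto simp: y_def c_def c'_def)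
  have 1: "p ! y = (if odd k \<and> y = c then H else D)"
    using unit_segment_nth[OF s(1), of y] y by (simp add: c_def)
  have 2: "p ! y = (if y < c' then U else if odd k' \<and> y = c' then H else D)"
    using unit_segment_nth[OF s(2), of y] y by (simp add: c'_def)
  have "y = c'" using 1 2 y(3) by (auto split: if_splits)
  then have "i' = c'" using less by (simp add: y_def)
  then have "k' div 2 = 0" by (simp add: c'_def)
  then have "k' = 1" using pos(2) by presburger
  then show False using 1 2 \<open>y = c'\<close> less by auto
qed

section \<open>Heights and marks within one segment\<close>

lemma height_Suc: "j < length p \<Longrightarrow> height p (Suc j) = height p j + rise (p ! j)"
  by (simp add: height_def take_Suc_conv_app_nth)

lemma height_unit_segment:
  assumes "unit_segment p (i, k)" "j \<le> k"
  shows "height p (i + j) = height p i + int (min j (k - j))"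
  using assms(2)
proof (induction j)
  case (Suc j)
  then have "height p (i + Suc j) = height p i + int (min j (k - j)) + rise (p ! (i + j))"
    using unit_segment_pos[OF assms(1)] by (simp add: height_Suc)
  moreover have "p ! (i + j) = (if j < k div 2 then U else if odd k \<and> j = k div 2 then H else D)"
    using unit_segment_nth[OF assms(1), of "i + j"] Suc.prems by simp
  moreover have "int (min j (k - j)) + rise (if j < k div 2 then U else if odd k \<and> j = k div 2 then H else D)
      = int (min (Suc j) (k - Suc j))"
    using Suc.prems by (cases "even k") (auto elim!: evenE oddE simp: min_def)
  ultimately show ?case by simp
qed simp

text \<open>Stability on an increasing list means that ties in the key are broken by position, left
  before right.\<close>

lemma sort_key_stable_order:
  fixes f :: "nat \<Rightarrow> 'b :: linorder"
  assumes "sorted_wrt (<) xs"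
  shows "sorted_wrt (\<lambda>y z. f y < f z \<or> (f y = f z \<and> y < z)) (sort_key f xs)"
  using assms
proof (induction xs)
  case (Cons x xs)
  have "sorted_wrt (\<lambda>y z. f y < f z \<or> (f y = f z \<and> y < z)) (insort_key f x ys)"
    if "sorted_wrt (\<lambda>y z. f y < f z \<or> (f y = f z \<and> y < z)) ys" "\<forall>y\<in>set ys. x < y" for ys
    using that by (induction ys) (auto simp: set_insort_key)
  then show ?case using Cons by simp
qed simp

context
  fixes p :: path and i k r :: nat
  assumes seg: "unit_segment p (i, k)" and r: "0 < r" "r < k"
begin

private definition S where "S = segment_marks r p (i, k)"

private lemma S_sub: "S \<subseteq> {i..i + k}"
  using set_take_subset[of r "sort_key (\<lambda>j. - height p j) [i..<Suc (i + k)]"]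
  by (auto simp: S_def segment_marks_def simp del: upt_Suc)

private lemma card_S: "card S = r"
proof -
  have "distinct (sort_key (\<lambda>j. - height p j) [i..<Suc (i + k)])" by (simp del: upt_Suc)
  then have "distinct (take r (sort_key (\<lambda>j. - height p j) [i..<Suc (i + k)]))"
    by (rule distinct_take)
  then show ?thesis using r by (simp add: S_def segment_marks_def distinct_card del: upt_Suc)
qed

text \<open>The marking order: a marked point is higher than an unmarked one, or level with it and
  to its left. The properties of marks below follow from this and \<open>card_S\<close>.\<close>

private lemma S_before:
  assumes "i + l \<in> S" "i + j \<notin> S" "j \<le> k"
  shows "min j (k - j) < min l (k - l) \<or> (min j (k - j) = min l (k - l) \<and> l < j)"
proof -
  let ?f = "\<lambda>j. - height p j"
  let ?xs = "sort_key ?f [i..<Suc (i + k)]"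
  have "sorted_wrt (\<lambda>y z. ?f y < ?f z \<or> (?f y = ?f z \<and> y < z)) (take r ?xs @ drop r ?xs)"
    unfolding append_take_drop_id by (rule sort_key_stable_order) (rule sorted_wrt_upt)
  moreover have "i + l \<in> set (take r ?xs)" using assms(1) by (simp add: S_def segment_marks_def)
  moreover have "i + j \<in> set (drop r ?xs)"
  proof -
    have "i + j \<in> set ?xs" using assms(3) by (simp del: upt_Suc)
    then have "i + j \<in> set (take r ?xs) \<union> set (drop r ?xs)"
      by (metis append_take_drop_id set_append)
    then show ?thesis using assms(2) by (simp add: S_def segment_marks_def)
  qed
  ultimately have "?f (i + l) < ?f (i + j) \<or> (?f (i + l) = ?f (i + j) \<and> i + l < i + j)"
    unfolding sorted_wrt_append by blast
  moreover have "l \<le> k" using assms(1) S_sub by auto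
  ultimately show ?thesis
    using height_unit_segment[OF seg assms(3)] height_unit_segment[OF seg, of l] by auto
qed

text \<open>The centre is the leftmost highest point, hence the first to be marked.\<close>

lemma segment_marks_key: "i + k div 2 \<in> segment_marks r p (i, k)"
proof (rule ccontr)
  assume "i + k div 2 \<notin> segment_marks r p (i, k)"
  then have n: "i + k div 2 \<notin> S" by (simp add: S_def)
  obtain y where "y \<in> S" using card_S r by fastforce
  then obtain l where "y = i + l" "i + l \<in> S" "l \<le> k" using S_sub
    by (metis atLeastAtMost_iff le_Suc_ex nat_add_left_cancel_le subsetD)
  then show False using S_before[OF _ n, of l] by (auto simp: min_def split: if_splits)
qed

lemma card_segment_marks: "card (segment_marks r p (i, k)) = r"
  using card_S by (simp add: S_def)

text \<open>Heights rise and then fall along the segment, so a point strictly between two others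
  cannot come after both in the marking order.\<close>

lemma segment_marks_convex:
  assumes "y \<in> segment_marks r p (i, k)" "z \<in> segment_marks r p (i, k)" "y < x" "x < z"
  shows "x \<in> segment_marks r p (i, k)"
proof (rule ccontr)
  assume n: "x \<notin> segment_marks r p (i, k)"
  have "y \<in> {i..i + k}" "z \<in> {i..i + k}" using assms S_sub by (auto simp: S_def)
  then obtain a b c where abc: "y = i + a" "x = i + b" "z = i + c" "a < b" "b < c" "c \<le> k"
    using assms(3,4) that[of "y - i" "x - i" "z - i"] by force
  then have "min b (k - b) < min a (k - a) \<or> (min b (k - b) = min a (k - a) \<and> a < b)"
    "min b (k - b) < min c (k - c) \<or> (min b (k - b) = min c (k - c) \<and> c < b)"
    using S_before[of a b] S_before[of c b] assms(1,2) n by (auto simp: S_def)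
  then show False using abc by (auto simp: min_def split: if_splits)
qed

text \<open>Let \<open>d\<close> be the relative height of the unmarked point. The marks have
  relative height at least \<open>d\<close>, and by the rule for ties they miss the right end of
  that range, so at most \<open>k - 2 * d\<close> points are available.\<close>

lemma segment_marks_room:
  assumes "j \<le> k" "i + j \<notin> segment_marks r p (i, k)"
  shows "r + 2 * min j (k - j) \<le> k"
proof -
  let ?d = "min j (k - j)"
  have "S \<subseteq> {i + ?d..<i + k - ?d}"
  proof
    fix y assume y: "y \<in> S"
    then obtain l where l: "y = i + l" "l \<le> k" using S_sub
      by (metis atLeastAtMost_iff le_Suc_ex nat_add_left_cancel_le subsetD)
    then have "?d < min l (k - l) \<or> (?d = min l (k - l) \<and> l < j)"
      using S_before[of l j] y assms by (simp add: S_def)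
    then show "y \<in> {i + ?d..<i + k - ?d}"
      using l assms(1) by (auto simp: min_def split: if_splits)
  qed
  then have "r \<le> card {i + ?d..<i + k - ?d}" using card_S card_mono by (metis finite_atLeastLessThan)
  then show ?thesis using r by simp
qed

text \<open>The two endpoints are the last of the \<open>k + 1\<close> points to be marked, the
  right one after the left, and \<open>r < k\<close>.\<close>

lemma segment_marks_interior: "segment_marks r p (i, k) \<subseteq> {i<..<i + k}"
proof -
  have "i \<notin> S"
  proof
    assume "i \<in> S"
    have "{i..<i + k} \<subseteq> S"
    proof
      fix x assume "x \<in> {i..<i + k}"
      then obtain j where j: "x = i + j" "j < k" using le_Suc_ex by fastforce
      show "x \<in> S"
      proof (rule ccontr)
        assume "x \<notin> S"
        then show False using S_before[of 0 j] j \<open>i \<in> S\<close>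
          by (cases "j = 0") (auto simp: min_def split: if_splits)
      qed
    qed
    then have "card {i..<i + k} \<le> card S" using S_sub finite_subset by (intro card_mono) auto
    then show False using card_S r by simp
  qed
  moreover have "i + k \<notin> S"
  proof
    assume "i + k \<in> S"
    then show False using S_before[of k 0] \<open>i \<notin> S\<close> by simp
  qed
  ultimately have "i < x \<and> x < i + k" if "x \<in> S" for x
    using that S_sub by (metis atLeastAtMost_iff less_le subsetD)
  then show ?thesis unfolding S_def[symmetric] by auto
qed

end

section \<open>Labels\<close>

fun nkeys :: "path \<Rightarrow> nat" where
  "nkeys [] = 0"
| "nkeys (H # w) = Suc (nkeys w)"
| "nkeys (U # w) = (if w \<noteq> [] \<and> hd w = D then 1 else 0) + nkeys w"
| "nkeys (D # w) = nkeys w"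

lemma is_key_Nil [simp]: "is_key [] = (\<lambda>j. False)"
  by (simp add: is_key_def fun_eq_iff)

lemma finite_keys: "finite {j. is_key w j \<and> P j}"
  by (rule finite_subset[of _ "{..<length w}"]) (auto simp: is_key_def)

lemma card_keys: "card {j. is_key w j} = nkeys w"
proof (induction w)
  case Nil then show ?case by simp
next
  case (Cons s w)
  have fin: "finite {j. is_key w j}" using finite_keys[of w "\<lambda>_. True"] by simp
  have Suc: "is_key (s # w) (Suc j) \<longleftrightarrow> is_key w j \<or> (j = 0 \<and> s = U \<and> w \<noteq> [] \<and> hd w = D)" for j
    by (cases j) (auto simp: is_key_def hd_conv_nth)
  have zero: "is_key (s # w) 0 \<longleftrightarrow> s = H" by (simp add: is_key_def)
  have split: "{j. is_key (s # w) j} = (if s = H then {0} else {}) \<union> (if s = U \<and> w \<noteq> [] \<and> hd w = D then {1} else {})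
      \<union> Suc ` {j. is_key w j}"
  proof (rule set_eqI)
    fix j show "j \<in> {j. is_key (s # w) j} \<longleftrightarrow> j \<in> (if s = H then {0} else {})
        \<union> (if s = U \<and> w \<noteq> [] \<and> hd w = D then {1} else {}) \<union> Suc ` {j. is_key w j}"
      by (cases j) (auto simp: Suc zero)
  qed
  have "hd w = D \<Longrightarrow> w \<noteq> [] \<Longrightarrow> \<not> is_key w 0" by (simp add: is_key_def hd_conv_nth)
  then show ?case unfolding split
    using fin Cons by (cases s) (auto simp: card_image card_insert_if image_iff)
qed

lemma card_keys_above:
  assumes "\<not> is_key p x"
  shows "card {j. is_key p j \<and> x < j} = nkeys (drop x p)"
proof -
  have "{j. is_key p j \<and> x < j} = (\<lambda>j. x + j) ` {j. is_key (drop x p) j}"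
  proof (rule set_eqI)
    fix j
    have 1: "is_key p (x + Suc l) \<longleftrightarrow> is_key (drop x p) (Suc l)" for l
      by (auto simp: is_key_def)
    have 2: "\<not> is_key (drop x p) 0" using assms by (auto simp: is_key_def)
    consider "j \<le> x" | l where "j = x + Suc l" by (metis less_imp_Suc_add add_Suc_right not_less)
    then show "j \<in> {j. is_key p j \<and> x < j} \<longleftrightarrow> j \<in> (\<lambda>j. x + j) ` {j. is_key (drop x p) j}"
    proof cases
      case 1
      then show ?thesis using 2 by (auto simp: le_Suc_eq)
    next
      case (2 l)
      then show ?thesis using 1[of l] by (simp add: image_iff)
    qed
  qed
  then show ?thesis by (simp add: card_image card_keys)
qed

text \<open>A cut can destroy a key only by separating a U from the D that follows it.\<close>

lemma nkeys_append: "a = [] \<or> last a \<noteq> U \<or> b = [] \<or> hd b \<noteq> D \<Longrightarrow> nkeys (a @ b) = nkeys a + nkeys b"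
proof (induction a)
  case (Cons s a)
  then have "nkeys (a @ b) = nkeys a + nkeys b" by (cases "a = []") auto
  then show ?case using Cons.prems by (cases s) (auto simp: hd_append)
qed simp

lemma nkeys_unit_path: "0 < k \<Longrightarrow> nkeys (unit_path k) = 1"
  by (simp add: card_keys[symmetric] is_key_unit_path)

text \<open>Keys are the leaves of the forest: an H, or an arch around nothing. With
  \<open>length_parts\<close>, there are as many keys as parts.\<close>

lemma nkeys_word: "nkeys (word t) = count (longs t) 1 + count (longs t) 2"
proof (induction t)
  case (Arch s t)
  have "nkeys (word s @ D # word t) = nkeys (word s) + nkeys (word t)"
    using last_word[of s] by (subst nkeys_append) auto
  moreover have "hd (word s @ D # word t) = D \<longleftrightarrow> s = Empty"
    using hd_word[of s] by (cases s) auto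
  ultimately show ?case using Arch by simp
qed auto

context
  fixes p :: path and r :: nat
  assumes r: "0 < r" and long: "\<And>i k. (i, k) \<in> unital_segments p \<Longrightarrow> r < k"
begin

private lemma unital: "(i, k) \<in> unital_segments p \<Longrightarrow> unit_segment p (i, k)"
  by (simp add: unital_segments_def)

lemma finite_unital: "finite (unital_segments p)"
  using bij_betw_finite[OF bij_betw_unital_key[of p]] finite_keys[of p "\<lambda>_. True"] by simp

lemma key_marked: "is_key p j \<Longrightarrow> j \<in> marked r p"
proof -
  assume j: "is_key p j"
  then have "j \<in> (\<lambda>(i, k). i + k div 2) ` unital_segments p"
    using bij_betw_imp_surj_on[OF bij_betw_unital_key[of p]] by simp
  then obtain i k where s: "(i, k) \<in> unital_segments p" "i + k div 2 = j" by auto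
  then have "j \<in> segment_marks r p (i, k)"
    using segment_marks_key[OF unital[OF s(1)] r long[OF s(1)]] by simp
  then show ?thesis using s(1) by (auto simp: marked_def)
qed

lemma marked_interior: "y \<in> marked r p \<Longrightarrow> 0 < y \<and> y < length p"
  using segment_marks_interior[OF unital r long] unit_segment_pos[OF unital]
  by (fastforce simp: marked_def)

text \<open>The marks of a segment form an interval around its key. As \<open>x\<close> is unmarked,
  they lie on the same side of \<open>x\<close> as the key, and different segments have disjoint
  marks.\<close>

lemma card_marked_above:
  assumes x: "x \<notin> marked r p"
  shows "card {y \<in> marked r p. x < y} = r * nkeys (drop x p)"
proof -
  define T where "T = {(i, k) \<in> unital_segments p. x < i + k div 2}"
  have T: "T \<subseteq> unital_segments p" by (auto simp: T_def)
  have key: "\<not> is_key p x" using x key_marked by blast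
  have eq: "{y \<in> marked r p. x < y} = (\<Union>s\<in>T. segment_marks r p s)"
  proof (rule set_eqI, rule iffI)
    fix y assume "y \<in> {y \<in> marked r p. x < y}"
    then obtain i k where s: "(i, k) \<in> unital_segments p" "y \<in> segment_marks r p (i, k)" "x < y"
      by (auto simp: marked_def)
    note mk = segment_marks_key[OF unital[OF s(1)] r long[OF s(1)]]
    have xs: "x \<notin> segment_marks r p (i, k)" using x s(1) by (auto simp: marked_def)
    then have "x \<noteq> i + k div 2" using mk by auto
    moreover have "\<not> i + k div 2 < x"
      using segment_marks_convex[OF unital[OF s(1)] r long[OF s(1)] mk s(2), of x] xs s(3) by blast
    ultimately have "(i, k) \<in> T" using s(1) by (simp add: T_def)
    then show "y \<in> (\<Union>s\<in>T. segment_marks r p s)" using s(2) by blast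
  next
    fix y assume "y \<in> (\<Union>s\<in>T. segment_marks r p s)"
    then obtain i k where s: "(i, k) \<in> unital_segments p" "y \<in> segment_marks r p (i, k)" "x < i + k div 2"
      by (auto simp: T_def)
    note mk = segment_marks_key[OF unital[OF s(1)] r long[OF s(1)]]
    have y: "y \<in> marked r p" using s by (auto simp: marked_def)
    have xs: "x \<notin> segment_marks r p (i, k)" using x s(1) by (auto simp: marked_def)
    have "\<not> y < x"
      using segment_marks_convex[OF unital[OF s(1)] r long[OF s(1)] s(2) mk, of x] xs s(3) by blast
    moreover have "y \<noteq> x" using x y by blast
    ultimately show "y \<in> {y \<in> marked r p. x < y}" using y by simp
  qed
  \<comment> \<open>Marks are interior points, so a common mark would make the segments share a step
    and hence a centre.\<close>
  have disj: "segment_marks r p s \<inter> segment_marks r p s' = {}" if "s \<in> T" "s' \<in> T" "s \<noteq> s'" for s s'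
  proof (rule ccontr)
    obtain i k i' k' where ik: "s = (i, k)" "s' = (i', k')" by fastforce
    assume "segment_marks r p s \<inter> segment_marks r p s' \<noteq> {}"
    then obtain y where y: "y \<in> segment_marks r p (i, k)" "y \<in> segment_marks r p (i', k')"
      using ik by blast
    have u: "(i, k) \<in> unital_segments p" "(i', k') \<in> unital_segments p" using that ik T by auto
    have "y \<in> {i<..<i + k}" "y \<in> {i'<..<i' + k'}"
      using y segment_marks_interior[OF unital[OF u(1)] r long[OF u(1)]]
        segment_marks_interior[OF unital[OF u(2)] r long[OF u(2)]] by blast+
    then have "i + k div 2 = i' + k' div 2"
      using unit_segments_overlap[OF unital[OF u(1)] unital[OF u(2)], of y]
        unit_segments_overlap[OF unital[OF u(2)] unital[OF u(1)], of y] by auto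
    then have "s = s'"
      using inj_onD[OF bij_betw_imp_inj_on[OF bij_betw_unital_key[of p]], of s s'] u ik by simp
    then show False using that by simp
  qed
  have "card (\<Union>s\<in>T. segment_marks r p s) = (\<Sum>s\<in>T. card (segment_marks r p s))"
  proof (rule card_UN_disjoint)
    show "finite T" using T finite_unital finite_subset by blast
    show "\<forall>s\<in>T. finite (segment_marks r p s)" by (auto simp: segment_marks_def)
  qed (use disj in blast)
  also have "\<dots> = (\<Sum>s\<in>T. r)"
    using card_segment_marks[OF unital r long] T by (intro sum.cong) auto
  also have "\<dots> = r * card T" by simp
  also have "card T = card {j. is_key p j \<and> x < j}"
  proof (rule bij_betw_same_card)
    show "bij_betw (\<lambda>(i, k). i + k div 2) T {j. is_key p j \<and> x < j}"
    proof (rule bij_betw_subset[OF bij_betw_unital_key[of p] T])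
      have "(\<lambda>(i, k). i + k div 2) ` T
          = {j \<in> (\<lambda>(i, k). i + k div 2) ` unital_segments p. x < j}"
        unfolding T_def by force
      also have "\<dots> = {j. is_key p j \<and> x < j}"
        using bij_betw_imp_surj_on[OF bij_betw_unital_key[of p]] by auto
      finally show "(\<lambda>(i, k). i + k div 2) ` T = {j. is_key p j \<and> x < j}" .
    qed
  qed
  finally show ?thesis using card_keys_above[OF key] by (simp add: eq)
qed

lemma length_labeled_points: "length (labeled_points r p) + r * nkeys p = Suc (length p)"
proof -
  have 0: "0 \<notin> marked r p" using marked_interior by blast
  have "{y \<in> marked r p. 0 < y} = marked r p" using marked_interior by blast
  then have card: "card (marked r p) = r * nkeys p" using card_marked_above[OF 0] by simp
  have sub: "marked r p \<subseteq> {0..<Suc (length p)}" using marked_interior by fastforce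
  have "length (labeled_points r p) = card {j \<in> {0..<Suc (length p)}. j \<notin> marked r p}"
    by (subst distinct_card[symmetric]) (auto simp: labeled_points_def simp del: upt_Suc)
  also have "{j \<in> {0..<Suc (length p)}. j \<notin> marked r p} = {0..<Suc (length p)} - marked r p" by auto
  also have "card \<dots> = Suc (length p) - r * nkeys p"
    using sub card by (simp add: card_Diff_subset finite_subset)
  moreover have "r * nkeys p \<le> Suc (length p)"
    using card_mono[OF _ sub] card by simp
  ultimately show ?thesis by simp
qed

lemma labeled_points_antimono:
  assumes "a < b" "b < length (labeled_points r p)"
  shows "labeled_points r p ! b < labeled_points r p ! a"
proof -
  have "sorted_wrt (<) (filter (\<lambda>j. j \<notin> marked r p) [0..<Suc (length p)])"
    by (intro sorted_wrt_filter sorted_wrt_upt)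
  then have "sorted_wrt (>) (labeled_points r p)"
    unfolding labeled_points_def by (simp add: sorted_wrt_rev del: upt_Suc)
  then show ?thesis using sorted_wrt_nth_less[OF _ assms] by blast
qed

text \<open>The points to the right of \<open>x\<close> are those with labels below
  \<open>a\<close>, and \<open>r\<close> marked ones for each key there.\<close>

lemma labeled_point:
  assumes a: "a < length (labeled_points r p)" and x: "x = labeled_points r p ! a"
  shows "x \<notin> marked r p" "x \<le> length p" "x + r * nkeys (drop x p) + a = length p"
proof -
  let ?L = "labeled_points r p"
  have set: "set ?L = {j. j \<le> length p \<and> j \<notin> marked r p}"
    by (auto simp: labeled_points_def simp del: upt_Suc)
  have "x \<in> set ?L" using a x by simp
  then show 1: "x \<notin> marked r p" and 2: "x \<le> length p" using set by auto
  have dist: "distinct ?L" by (simp add: labeled_points_def del: upt_Suc)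
  have "{y \<in> set ?L. x < y} = (\<lambda>b. ?L ! b) ` {..<a}"
  proof (rule set_eqI, rule iffI)
    fix y assume "y \<in> {y \<in> set ?L. x < y}"
    then obtain b where b: "b < length ?L" "y = ?L ! b" "x < y" by (auto simp: in_set_conv_nth)
    then have "\<not> a \<le> b" using labeled_points_antimono[of a b] x by (cases "a = b") auto
    then show "y \<in> (\<lambda>b. ?L ! b) ` {..<a}" using b by auto
  next
    fix y assume "y \<in> (\<lambda>b. ?L ! b) ` {..<a}"
    then show "y \<in> {y \<in> set ?L. x < y}" using labeled_points_antimono[of _ a] a x by auto
  qed
  moreover have "inj_on (\<lambda>b. ?L ! b) {..<a}"
    using dist a by (auto simp: inj_on_def nth_eq_iff_index_eq)
  ultimately have "card {y \<in> set ?L. x < y} = a" by (simp add: card_image)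
  moreover have "card {y \<in> marked r p. x < y} = r * nkeys (drop x p)" using card_marked_above[OF 1] .
  moreover have "{x<..length p} = {y \<in> set ?L. x < y} \<union> {y \<in> marked r p. x < y}"
    using less_imp_le[OF conjunct2[OF marked_interior]] unfolding set by auto
  moreover have "finite {y \<in> marked r p. x < y}"
    by (rule finite_subset[of _ "{..length p}"]) (use less_imp_le[OF conjunct2[OF marked_interior]] in auto)
  ultimately have "card {x<..length p} = a + r * nkeys (drop x p)"
    using set by (simp add: card_Un_disjoint disjoint_iff)
  then show "x + r * nkeys (drop x p) + a = length p" using 2 by simp
qed

text \<open>The given unit path lies \<open>e\<close> layers deep in a unital segment of length
  \<open>K = k + 2 + 2 * e\<close>. As \<open>x\<close> is strictly inside, its relative height
  there is at least \<open>e + 1\<close>, and \<open>segment_marks_room\<close> applies.\<close>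

lemma unmarked_not_small:
  assumes x: "x \<notin> marked r p" and p: "p = a @ unit_path (k + 2) @ b"
    and ax: "length a < x" "x \<le> length a + 1 + k"
  shows "r \<le> k"
proof -
  have "unit_segment p (length a, k + 2)"
    using unit_segment_append[OF unit_segment_unit_path[of "k + 2"], of a b] p by simp
  then obtain i K where s: "(i, K) \<in> unital_segments p" "i + K div 2 = length a + (k + 2) div 2"
    "k + 2 \<le> K" "i \<le> length a" "length a + (k + 2) \<le> i + K" "even (K - (k + 2))"
    by (rule unital_exists)
  obtain e where e: "K = k + 2 + 2 * e" using s(3,6) by (metis evenE le_add_diff_inverse)
  then have i: "length a = i + e" using s(2) by simp
  obtain j where j: "x = i + j" using ax i le_Suc_ex[of i x] by auto
  have "x \<notin> segment_marks r p (i, K)" using x s(1) by (auto simp: marked_def)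
  then have "r + 2 * min j (K - j) \<le> K"
    using segment_marks_room[OF unital[OF s(1)] r long[OF s(1)], of j] j ax i e by simp
  then show ?thesis using ax i j e by (auto simp: min_def split: if_splits)
qed

end

text \<open>A unital segment is the longest unit segment with its centre.\<close>

lemma exact_unital_long:
  assumes "exact r t" "0 < r" "(i, k) \<in> unital_segments (word t)"
  shows "r < k"
proof -
  have "is_key (word t) (i + k div 2)"
    using assms(3) unit_segment_key(1) by (auto simp: unital_segments_def)
  then obtain i' k' where "unit_segment (word t) (i', k')" "i' + k' div 2 = i + k div 2" "r < k'"
    using exact_key_segment[OF assms(1,2)] by blast
  then show ?thesis using unital_max[OF assms(3)] by fastforce
qed

lemma unmarked_roomy:
  assumes "exact r t" "0 < r" "x \<notin> marked r (word t)" "x \<le> length (word t)"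
  shows "roomy r x t"
proof (rule ccontr)
  assume "\<not> roomy r x t"
  then obtain a k b where "word t = a @ unit_path (k + 2) @ b" "k < r" "length a < x"
    "x \<le> length a + 1 + k"
    using tight_not_roomy[OF exact_imp_tight[OF assms(1)]] assms(4) by blast
  then show False
    using unmarked_not_small[of r "word t" x a k b] exact_unital_long[OF assms(1,2)] assms(2,3) by simp
qed

section \<open>The major indices\<close>

definition joint :: "path \<Rightarrow> path \<Rightarrow> nat" where
  "joint a b = (if a \<noteq> [] \<and> b \<noteq> [] \<and> last a \<noteq> U \<and> hd b \<noteq> D then 1 else 0)"

lemma weak_valleys_iff:
  "i \<in> weak_valleys p \<longleftrightarrow> 1 \<le> i \<and> i < length p \<and> p ! (i - 1) \<noteq> U \<and> p ! i \<noteq> D"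
  unfolding weak_valleys_def by (cases "p ! (i - 1)"; cases "p ! i") auto

lemma weak_peaks_iff:
  "i \<in> weak_peaks p \<longleftrightarrow> 1 \<le> i \<and> i < length p \<and> (p ! (i - 1) = U \<or> p ! i = D)"
  unfolding weak_peaks_def by (cases "p ! (i - 1)"; cases "p ! i") auto

lemma finite_weak_valleys: "finite (weak_valleys p)"
  by (rule finite_subset[of _ "{..<length p}"]) (auto simp: weak_valleys_iff)

lemma weak_valleys_append:
  "weak_valleys (a @ b) = weak_valleys a \<union> (if joint a b = 1 then {length a} else {})
     \<union> (\<lambda>i. length a + i) ` weak_valleys b"
proof (rule set_eqI)
  fix i
  consider "i < length a" | "i = length a" | l where "i = length a + Suc l"
    by (metis less_imp_Suc_add linorder_neqE_nat add_Suc_right)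
  then show "i \<in> weak_valleys (a @ b) \<longleftrightarrow> i \<in> weak_valleys a \<union>
      (if joint a b = 1 then {length a} else {}) \<union> (\<lambda>i. length a + i) ` weak_valleys b"
  proof cases
    case 1
    then show ?thesis by (auto simp: weak_valleys_iff nth_append)
  next
    case 2
    then show ?thesis
      by (auto simp: weak_valleys_iff nth_append joint_def last_conv_nth hd_conv_nth Suc_le_eq)
  next
    case (3 l)
    then show ?thesis by (auto simp: weak_valleys_iff nth_append joint_def image_iff)
  qed
qed

lemma comaj_append:
  "comaj (a @ b) = comaj a + joint a b * length a + comaj b + length a * card (weak_valleys b)"
  "card (weak_valleys (a @ b)) = card (weak_valleys a) + joint a b + card (weak_valleys b)"
proof -
  have img: "(\<Sum>i\<in>(\<lambda>i. length a + i) ` weak_valleys b. i) = comaj b + length a * card (weak_valleys b)"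
    by (simp add: sum.reindex sum.distrib comaj_def)
  have j: "joint a b = (if joint a b = 1 then 1 else 0)" by (simp add: joint_def)
  have d: "weak_valleys a \<inter> (if joint a b = 1 then {length a} else {}) = {}"
    "(weak_valleys a \<union> (if joint a b = 1 then {length a} else {})) \<inter> (\<lambda>i. length a + i) ` weak_valleys b = {}"
    by (auto simp: weak_valleys_iff)
  show "comaj (a @ b) = comaj a + joint a b * length a + comaj b + length a * card (weak_valleys b)"
    unfolding comaj_def[of "a @ b"] weak_valleys_append
    using j d img
    by (simp add: sum.union_disjoint finite_weak_valleys comaj_def split: if_splits)
  show "card (weak_valleys (a @ b)) = card (weak_valleys a) + joint a b + card (weak_valleys b)"
    unfolding weak_valleys_append
    using j d by (simp add: card_Un_disjoint finite_weak_valleys card_image split: if_splits)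
qed

text \<open>Cutting at the weak valleys leaves pieces consisting of U steps, at most one H, and D
  steps, in this order. Each contains exactly one key, except a first piece that starts with D; the
  assumption excludes a last piece of U steps only.\<close>

lemma nkeys_eq_valleys:
  "b = [] \<or> last b \<noteq> U \<Longrightarrow>
    nkeys b = card (weak_valleys b) + (if b \<noteq> [] \<and> hd b \<noteq> D then 1 else 0)"
proof (induction b)
  case Nil then show ?case by (simp add: weak_valleys_def)
next
  case (Cons s b)
  have "weak_valleys [s] = {}" by (auto simp: weak_valleys_iff)
  then have "card (weak_valleys (s # b)) = joint [s] b + card (weak_valleys b)"
    using comaj_append(2)[of "[s]" b] by simp
  moreover have "nkeys b = card (weak_valleys b) + (if b \<noteq> [] \<and> hd b \<noteq> D then 1 else 0)"
    using Cons by (cases "b = []") auto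
  ultimately show ?case using Cons.prems by (cases s) (auto simp: joint_def)
qed

lemma weak_valleys_unit_path: "weak_valleys (unit_path k) = {}"
  by (auto simp: weak_valleys_iff nth_unit_path split: if_splits)

lemma hd_unit_path: "0 < k \<Longrightarrow> hd (unit_path k) \<noteq> D"
  and last_unit_path: "0 < k \<Longrightarrow> last (unit_path k) \<noteq> U"
  by (cases k rule: unit_tree.cases; simp)+

text \<open>The net effect is one more weak valley at \<open>length a\<close> and a shift by
  \<open>r\<close> of those to its right, including one at the right end of the copy. By
  \<open>nkeys_eq_valleys\<close> there are \<open>nkeys b\<close> of the latter.\<close>

lemma comaj_insert_unit_path:
  assumes r: "0 < r" and a: "a = [] \<or> last a \<noteq> U \<or> (b \<noteq> [] \<and> hd b \<noteq> D)"
    and b: "b = [] \<or> last b \<noteq> U"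
  shows "comaj (a @ unit_path r @ b) = comaj (a @ b) + length a + r * nkeys b"
proof -
  let ?u = "unit_path r"
  have u: "?u \<noteq> []" "hd ?u \<noteq> D" "last ?u \<noteq> U" "comaj ?u = 0"
    using r hd_unit_path[OF r] last_unit_path[OF r]
    by (simp_all add: comaj_def weak_valleys_unit_path flip: length_greater_0_conv)
  have nk: "nkeys b = joint ?u b + card (weak_valleys b)"
    using nkeys_eq_valleys[OF b] u by (auto simp: joint_def)
  \<comment> \<open>For bits \<open>x\<close> and \<open>y\<close>, \<open>x + y = x * y + 1\<close>
    holds as soon as one of them is 1, that is, when the seam of \<open>a\<close> and
    \<open>b\<close> is not a peak.\<close>
  have "a \<noteq> [] \<Longrightarrow> joint a (?u @ b) + joint ?u b = joint a b + 1"
    using u a by (auto simp: joint_def)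
  then have "(joint a (?u @ b) + joint ?u b) * length a = (joint a b + 1) * length a"
    by (cases "a = []") simp_all
  then have *: "joint a (?u @ b) * length a + joint ?u b * length a = joint a b * length a + length a"
    by (simp only: add_mult_distrib mult_1)
  have "comaj (a @ ?u @ b) = comaj a + joint a (?u @ b) * length a + joint ?u b * r + comaj b
      + r * card (weak_valleys b) + length a * (joint ?u b + card (weak_valleys b))"
    by (simp add: comaj_append u weak_valleys_unit_path)
  then show ?thesis using * unfolding nk comaj_append(1)[of a b] by (simp add: algebra_simps)
qed

lemma maj_add_comaj: "2 * (maj p + comaj p) = length p * (length p - 1)"
proof -
  have "weak_peaks p \<union> weak_valleys p = {1..<length p}" "weak_peaks p \<inter> weak_valleys p = {}"
    by (auto simp: weak_peaks_iff weak_valleys_iff)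
  then have "maj p + comaj p = \<Sum>{1..<length p}"
    unfolding maj_def comaj_def
    by (metis finite_Un finite_atLeastLessThan sum.union_disjoint)
  moreover have "even (length p * (length p - 1))" by (cases "length p") auto
  ultimately show ?thesis by (simp add: Sum_Ico_nat)
qed

text \<open>Fixed abscissae suffice: labels increase from right to left, so an insertion does not
  move the points with larger labels.\<close>

fun insert_all :: "path \<Rightarrow> nat list \<Rightarrow> path \<Rightarrow> path" where
  "insert_all u [] q = q"
| "insert_all u (x # xs) q = insert_all u xs (take x q @ u @ drop x q)"

text \<open>A label that has just been used sits to the right of \<open>k\<close> copies of \<open>u\<^sup>(\<^sup>r\<^sup>)\<close>, and inserting there
  gives the same word as inserting to their left.\<close>

lemma insert_units_eq_insert_all:
  assumes "sorted \<alpha>"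
    and "\<And>a b. a \<in> set \<alpha> \<Longrightarrow> b \<in> set \<alpha> \<Longrightarrow> a < b \<Longrightarrow> lab b < lab a"
    and "\<And>a. a \<in> set \<alpha> \<Longrightarrow> a \<noteq> hd \<alpha> \<Longrightarrow> pos a = lab a"
    and "\<And>a. a \<in> set \<alpha> \<Longrightarrow> lab a \<le> length q"
    and "\<alpha> \<noteq> [] \<Longrightarrow> \<exists>k w z. pos (hd \<alpha>) = lab (hd \<alpha>) + k * r \<and>
        q = w @ concat (replicate k (unit_path r)) @ z \<and> length w = lab (hd \<alpha>)"
  shows "insert_units r \<alpha> pos q = insert_all (unit_path r) (map lab \<alpha>) q"
  using assms
proof (induction \<alpha> arbitrary: pos q)
  case (Cons a \<alpha>)
  let ?u = "unit_path r"
  obtain k w z where k: "pos a = lab a + k * r" "q = w @ concat (replicate k ?u) @ z" "length w = lab a"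
    using Cons.prems(5) by auto
  have len: "length (concat (replicate k ?u)) = k * r"
    by (induction k) auto
  have comm: "concat (replicate k ?u) @ ?u = ?u @ concat (replicate k ?u)" for k
    by (induction k) auto
  define q' where "q' = take (lab a) q @ ?u @ drop (lab a) q"
  define pos' where "pos' = (\<lambda>b. if pos b < pos a then pos b else pos b + r)"
  have q'_alt: "q' = w @ concat (replicate (Suc k) ?u) @ z"
    using k(2,3) by (simp add: q'_def)
  have q': "take (pos a) q @ ?u @ drop (pos a) q = q'"
    using k(1,2,3) len comm[of k] by (simp add: q'_alt)
  have le: "a \<le> b" if "b \<in> set \<alpha>" for b using Cons.prems(1) that by simp
  have pos': "pos' b = lab b" if "b \<in> set \<alpha>" "b \<noteq> a" for b
  proof -
    have "lab b < lab a" using Cons.prems(2)[of a b] le that by fastforce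
    moreover have "pos b = lab b" using Cons.prems(3)[of b] that by simp
    ultimately show ?thesis using k(1) by (simp add: pos'_def)
  qed
  have lenq': "lab b \<le> length q'" if "b \<in> set \<alpha>" for b
    using Cons.prems(4)[of b] that by (simp add: q'_def)
  have "insert_units r \<alpha> pos' q' = insert_all ?u (map lab \<alpha>) q'"
  proof (rule Cons.IH)
    show "sorted \<alpha>" using Cons.prems(1) by simp
    show "lab c < lab b" if "b \<in> set \<alpha>" "c \<in> set \<alpha>" "b < c" for b c
      using Cons.prems(2)[of b c] that by simp
    show "lab b \<le> length q'" if "b \<in> set \<alpha>" for b using lenq' that .
    show "pos' b = lab b" if b: "b \<in> set \<alpha>" "b \<noteq> hd \<alpha>" for b
    proof (rule pos'[OF b(1)])
      show "b \<noteq> a"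
      proof
        assume "b = a"
        moreover have "hd \<alpha> \<in> set \<alpha>" using b by (cases \<alpha>) auto
        ultimately have "hd \<alpha> > b" using le[of "hd \<alpha>"] b(2) by simp
        moreover have "hd \<alpha> \<le> b" using Cons.prems(1) b(1) by (cases \<alpha>) auto
        ultimately show False by simp
      qed
    qed
    show "\<exists>k w z. pos' (hd \<alpha>) = lab (hd \<alpha>) + k * r \<and>
        q' = w @ concat (replicate k ?u) @ z \<and> length w = lab (hd \<alpha>)" if "\<alpha> \<noteq> []"
    proof (cases "hd \<alpha> = a")
      case True
      then show ?thesis using k q'_alt
        by (intro exI[of _ "Suc k"] exI[of _ w] exI[of _ z]) (simp add: pos'_def)
    next
      \<comment> \<open>A label used for the first time has not moved, hence no copies.\<close>
      case False
      then show ?thesis using pos'[of "hd \<alpha>"] lenq'[of "hd \<alpha>"] that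
        by (intro exI[of _ 0] exI[of _ "take (lab (hd \<alpha>)) q'"] exI[of _ "drop (lab (hd \<alpha>)) q'"]) simp
    qed
  qed
  then show ?case using q' by (simp add: pos'_def q'_def)
qed simp

lemma last_take_conv_nth: "0 < x \<Longrightarrow> x \<le> length q \<Longrightarrow> last (take x q) = q ! (x - 1)"
  by (subst last_conv_nth) (auto simp: min_def)

text \<open>\<open>i\<close> counts the copies inserted so far. They all stand to the right of the
  admissible points, and each adds one key there, so it increases each later contribution to
  \<open>comaj\<close> by \<open>r\<close>; the binomial coefficient sums these increases.\<close>

lemma insert_all_word:
  fixes X :: "nat set" and p :: path
  assumes r: "0 < r"
    and xs: "sorted_wrt (\<ge>) xs" "set xs \<subseteq> X"
    and inv: "\<And>x. x \<in> X \<Longrightarrow> xs \<noteq> [] \<Longrightarrow> x \<le> hd xs \<Longrightarrow> x \<le> length (word t) \<and> roomy r x t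
        \<and> \<not> (0 < x \<and> x < length (word t) \<and> word t ! (x - 1) = U \<and> word t ! x = D)
        \<and> nkeys (drop x (word t)) = nkeys (drop x p) + i"
  shows "\<exists>t'. insert_all (unit_path r) xs (word t) = word t' \<and>
    longs t' = longs t + sum_list (replicate (length xs) (chain r)) \<and>
    comaj (word t') = comaj (word t) + (\<Sum>x\<leftarrow>xs. x + r * nkeys (drop x p))
      + r * (i * length xs + (length xs choose 2))"
  using xs inv
proof (induction xs arbitrary: t i)
  case (Cons c xs)
  let ?u = "unit_path r" and ?q = "word t"
  have c: "c \<in> X" using Cons.prems(2) by simp
  have invc: "c \<le> length ?q" "roomy r c t"
    "\<not> (0 < c \<and> c < length ?q \<and> ?q ! (c - 1) = U \<and> ?q ! c = D)"
    "nkeys (drop c ?q) = nkeys (drop c p) + i"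
    using Cons.prems(3)[OF c] by auto
  define t' where "t' = ins (unit_tree r) c t"
  have t': "word t' = take c ?q @ ?u @ drop c ?q"
    using word_ins[OF invc(1), of "unit_tree r"] by (simp add: t'_def word_unit_tree)
  have longs: "longs t' = longs t + chain r"
    using roomy_ins[of "unit_tree r" c t] invc(2)
    by (simp add: t'_def peak_unit_tree longs_unit_tree)
  have lastq: "?q = [] \<or> last ?q \<noteq> U" using last_word by blast
  have nonpeak: "take c ?q = [] \<or> last (take c ?q) \<noteq> U \<or> (drop c ?q \<noteq> [] \<and> hd (drop c ?q) \<noteq> D)"
  proof (cases "c = 0 \<or> c = length ?q")
    case True then show ?thesis using lastq by auto
  next
    case False
    then show ?thesis using invc(1,3) by (auto simp: last_take_conv_nth hd_drop_conv_nth)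
  qed
  have "drop c ?q = [] \<or> last (drop c ?q) \<noteq> U" using lastq by (auto simp: last_drop)
  then have "comaj (word t') = comaj ?q + c + r * (nkeys (drop c p) + i)"
    using comaj_insert_unit_path[OF r nonpeak] invc(1,4) by (simp add: t')
  moreover have "\<exists>t''. insert_all ?u xs (word t') = word t'' \<and>
    longs t'' = longs t' + sum_list (replicate (length xs) (chain r)) \<and>
    comaj (word t'') = comaj (word t') + (\<Sum>x\<leftarrow>xs. x + r * nkeys (drop x p))
      + r * (Suc i * length xs + (length xs choose 2))"
  proof (rule Cons.IH)
    show "sorted_wrt (\<ge>) xs" "set xs \<subseteq> X" using Cons.prems by auto
    fix x assume x: "x \<in> X" "xs \<noteq> []" "x \<le> hd xs"
    have xc: "x \<le> c" using Cons.prems(1) x(2,3) by (cases xs) auto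
    have inv: "x \<le> length ?q" "roomy r x t"
      "\<not> (0 < x \<and> x < length ?q \<and> ?q ! (x - 1) = U \<and> ?q ! x = D)"
      "nkeys (drop x ?q) = nkeys (drop x p) + i"
      using Cons.prems(3)[OF x(1)] xc by auto
    have "\<not> (0 < x \<and> x < length (word t') \<and> word t' ! (x - 1) = U \<and> word t' ! x = D)"
    proof (cases "x = c")
      case True
      \<comment> \<open>When a point is reused, the next step is the first one of the copy just
        inserted.\<close>
      have "word t' ! x \<noteq> D"
        using True invc(1) hd_unit_path[OF r] length_unit_path[of r] r
        by (cases ?u) (auto simp: t' nth_append simp del: length_unit_path)
      then show ?thesis by simp
    next
      case False
      then have "x < c" using xc by simp
      then show ?thesis using inv(3) invc(1) by (auto simp: t' nth_append)
    qed
    \<comment> \<open>The new copy brings a single key, and neither of its seams destroys or creates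
      another.\<close>
    moreover have "nkeys (drop x (word t')) = nkeys (drop x p) + Suc i"
    proof -
      define w where "w = drop x (take c ?q)"
      have 1: "drop x (word t') = w @ ?u @ drop c ?q"
        using xc invc(1) by (simp add: t' w_def)
      have 2: "drop x ?q = w @ drop c ?q"
        using xc invc(1) by (metis append_take_drop_id drop_append w_def diff_is_0_eq' drop_0 length_take min.absorb2)
      have w: "w = [] \<or> last w \<noteq> U \<or> (drop c ?q \<noteq> [] \<and> hd (drop c ?q) \<noteq> D)"
      proof (cases "x < length (take c ?q)")
        case True
        then have "last w = last (take c ?q)" unfolding w_def by (rule last_drop)
        then show ?thesis using nonpeak True by fastforce
      next
        case False
        then have "w = []" unfolding w_def by (simp only: drop_all not_less)
        then show ?thesis by simp
      qed
      have u: "hd (?u @ drop c ?q) \<noteq> D" "?u \<noteq> []" "last ?u \<noteq> U"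
        using hd_unit_path[OF r] last_unit_path[OF r] length_unit_path[of r] r
        by (auto simp: hd_append simp del: length_unit_path)
      have "nkeys (drop x (word t')) = nkeys w + (1 + nkeys (drop c ?q))"
        using u by (simp add: 1 nkeys_append nkeys_unit_path[OF r])
      moreover have "nkeys (drop x ?q) = nkeys w + nkeys (drop c ?q)"
        unfolding 2 using w by (intro nkeys_append) auto
      ultimately show ?thesis using inv(4) by simp
    qed
    moreover have "roomy r x t'" using roomy_ins_mono[OF xc inv(2)] by (simp add: t'_def)
    ultimately show "x \<le> length (word t') \<and> roomy r x t'
        \<and> \<not> (0 < x \<and> x < length (word t') \<and> word t' ! (x - 1) = U \<and> word t' ! x = D)
        \<and> nkeys (drop x (word t')) = nkeys (drop x p) + Suc i"
      using inv(1) xc invc(1) by (simp add: t')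
  qed
  ultimately obtain t'' where t'': "insert_all ?u xs (word t') = word t''"
    "longs t'' = longs t' + sum_list (replicate (length xs) (chain r))"
    "comaj (word t'') = comaj ?q + c + r * (nkeys (drop c p) + i)
      + (\<Sum>x\<leftarrow>xs. x + r * nkeys (drop x p)) + r * (Suc i * length xs + (length xs choose 2))"
    by auto
  \<comment> \<open>The extra \<open>length xs\<close> matches the step from \<open>i\<close> to
    \<open>Suc i\<close> in the remaining insertions.\<close>
  have "length (c # xs) choose 2 = (length xs choose 2) + length xs"
    by (simp add: numeral_2_eq_2)
  then show ?case using t'' longs
    by (intro exI[of _ t'']) (simp add: t'[symmetric] algebra_simps)
qed (simp add: word_inject binomial_eq_0)


section \<open>Effect of the insertions on the parts\<close>

lemma parts_gt_imp_exact:
  assumes "\<forall>x\<in>set (parts (word t)). r < x"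
  shows "exact r t"
  unfolding exact_def
proof (intro allI impI)
  fix j assume j: "0 < j \<and> j \<le> r"
  then have "j \<notin> set (parts (word t))" using assms by auto
  then show "count (longs t) j = count (longs t) (j + 2)"
    using count_parts[of j t] j by (simp add: count_eq_zero_iff)
qed

text \<open>By \<open>count_parts\<close> the parts are differences of counts in
  \<open>longs\<close>, and each added chain changes only the difference at \<open>r\<close>. Zero
  is never a part.\<close>

lemma mset_parts_add:
  assumes "longs t' = longs t + sum_list (replicate m (chain r))" "0 < r"
  shows "mset (parts (word t')) = mset (parts (word t)) + replicate_mset m r"
proof (rule multiset_eqI)
  fix j
  show "count (mset (parts (word t'))) j = count (mset (parts (word t)) + replicate_mset m r) j"
  proof (cases "j = 0")
    case True
    have zero: "count (mset (parts (word s))) 0 = 0" for s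
      using parts_word(2)[of s] by (simp add: count_eq_zero_iff)
    show ?thesis unfolding True count_union zero using assms(2) by simp
  next
    case False
    have "count (sum_list (replicate m (chain r))) j
        = count (sum_list (replicate m (chain r))) (j + 2) + (if j = r then m else 0)"
      using count_chain[of j r] False by (induction m) auto
    then show ?thesis
      using count_parts[of j t] count_parts[of j t'] False assms(1) by simp
  qed
qed

theorem lemma3p9:
  fixes r m n :: nat and lam mu lam' \<alpha> :: "nat list" and p p' :: path
  assumes "0 < r"
    and "is_partition lam" and "lam \<noteq> []"
    and "mu = conjugate lam"
    and "r < mu ! (lam ! 0 - 1)"
    and "n = sum_list (drop r lam)"
    and "lam' = map (\<lambda>x. x + m) (take r lam) @ drop r lam"
    and "p \<in> paths_of_shape lam"
    and "\<alpha> \<in> inc_seqs n m"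
    and "p' = psi r \<alpha> p"
  shows "p' \<in> paths_of_shape lam' \<and>
    real (maj p') = real (maj p) + real (add \<alpha>)
      + real m * (real r - 1) * (real (length p) + real r * real m / 2) \<and>
    real (comaj p') = real (comaj p) - real (add \<alpha>)
      + real m * real (length p) + real r * real (m choose 2)"
proof -
  note r = assms(1)
  obtain t where t: "p = word t" and lam: "lam = conjugate (rev (sort (parts p)))"
    using assms(8) by (auto simp: paths_of_shape_def motzkin_iff_word theta_parts)
  have pos: "0 \<notin> set (parts p)" using parts_word(2) t by simp
  note shape = lam assms(3) pos assms(5)[unfolded assms(4)]
  have ex: "exact r t" using all_parts_gt[OF shape] t by (intro parts_gt_imp_exact) auto
  have long: "\<And>i k. (i, k) \<in> unital_segments p \<Longrightarrow> r < k"
    using exact_unital_long[OF ex r] t by simp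
  let ?L = "labeled_points r p"
  \<comment> \<open>The labels are exactly 0 to \<open>n\<close>: marking uses \<open>r\<close>
    points per key, and there are as many keys as parts.\<close>
  have len_L: "length ?L = Suc n"
  proof -
    have "n + r * length (parts p) = length p"
      using sum_drop_conjugate[OF shape] assms(6) sum_list_parts t by simp
    moreover have "length (parts p) = nkeys p" using length_parts nkeys_word t by simp
    moreover have "length ?L + r * nkeys p = Suc (length p)"
      by (rule length_labeled_points[OF r long])
    ultimately show ?thesis by simp
  qed
  have \<alpha>: "length \<alpha> = m" "sorted \<alpha>" "\<And>a. a \<in> set \<alpha> \<Longrightarrow> a < length ?L"
    using assms(9) len_L by (auto simp: inc_seqs_def less_Suc_eq_le)
  define lab where "lab = (\<lambda>a. ?L ! a)"
  have label: "lab a \<notin> marked r p" "lab a \<le> length p"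
    "lab a + r * nkeys (drop (lab a) p) + a = length p" if "a \<in> set \<alpha>" for a
    using labeled_point[OF r _ \<alpha>(3)[OF that] refl] long unfolding lab_def by blast+
  have anti: "lab b < lab a" if "a \<in> set \<alpha>" "b \<in> set \<alpha>" "a < b" for a b
    unfolding lab_def
    by (rule labeled_points_antimono[OF r long that(3)]) (use \<alpha>(3) that in auto)
  define xs where "xs = map lab \<alpha>"
  have p': "p' = insert_all (unit_path r) xs p"
    unfolding assms(10) psi_def xs_def lab_def[symmetric]
  proof (rule insert_units_eq_insert_all[OF \<alpha>(2) anti])
    show "\<exists>k w z. lab (hd \<alpha>) = lab (hd \<alpha>) + k * r \<and>
        p = w @ concat (replicate k (unit_path r)) @ z \<and> length w = lab (hd \<alpha>)" if "\<alpha> \<noteq> []"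
      using label(2)[of "hd \<alpha>"] that
      by (intro exI[of _ 0] exI[of _ "take (lab (hd \<alpha>)) p"] exI[of _ "drop (lab (hd \<alpha>)) p"]) simp
  qed (use label(2) in auto)
  define X where "X = {x. x \<le> length p \<and> x \<notin> marked r p}"
  have "sorted_wrt (\<ge>) xs"
    unfolding xs_def sorted_wrt_map
    by (rule sorted_wrt_mono_rel[OF _ \<alpha>(2)]) (use anti in \<open>auto simp: le_less\<close>)
  moreover have "set xs \<subseteq> X" using label(1,2) by (auto simp: xs_def X_def)
  moreover have "x \<le> length (word t) \<and> roomy r x t
      \<and> \<not> (0 < x \<and> x < length (word t) \<and> word t ! (x - 1) = U \<and> word t ! x = D)
      \<and> nkeys (drop x (word t)) = nkeys (drop x p) + 0" if "x \<in> X" for x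
  proof -
    \<comment> \<open>In particular an unmarked point is not a UD peak.\<close>
    have "\<not> is_key p x" using key_marked[OF r long] that by (auto simp: X_def)
    then show ?thesis using that unmarked_roomy[OF ex r, of x]
      by (auto simp: X_def t is_key_def)
  qed
  ultimately obtain t' where t': "insert_all (unit_path r) xs (word t) = word t'"
    "longs t' = longs t + sum_list (replicate (length xs) (chain r))"
    "comaj (word t') = comaj (word t) + (\<Sum>x\<leftarrow>xs. x + r * nkeys (drop x p))
      + r * (0 * length xs + (length xs choose 2))"
    using insert_all_word[OF r, of xs X t p 0] by blast
  have p't: "p' = word t'" using p' t t'(1) by simp
  have len_xs: "length xs = m" using \<alpha>(1) by (simp add: xs_def)
  have parts: "mset (parts p') = mset (parts p) + replicate_mset m r"
    using mset_parts_add[OF t'(2) r] t p't len_xs by simp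
  have "p' \<in> paths_of_shape lam'"
    using conjugate_add_parts[OF shape parts] assms(7) p't
    by (simp add: paths_of_shape_def motzkin_word theta_parts)
  moreover have comaj: "comaj p' + add \<alpha> = comaj p + m * length p + r * (m choose 2)"
  proof -
    \<comment> \<open>By \<open>label(3)\<close>, an insertion at label \<open>a\<close> contributes
      \<open>length p - a\<close>, apart from the effect of earlier copies. The label is added on
      the left to avoid truncated subtraction.\<close>
    have "(\<Sum>x\<leftarrow>map lab as. x + r * nkeys (drop x p)) + sum_list as = length as * length p"
      if "set as \<subseteq> set \<alpha>" for as
      using that
    proof (induction as)
      case (Cons a as)
      then have "lab a + r * nkeys (drop (lab a) p) + a = length p"
        using label(3)[of a] by simp
      then show ?case using Cons by simp
    qed simp
    from this[of \<alpha>] show ?thesis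
      using t'(3) t p't len_xs \<alpha>(1) by (simp add: xs_def add_def)
  qed
  \<comment> \<open>The length of a path is the sum of its parts.\<close>
  moreover have len: "length p' = length p + r * m"
    using sum_list_parts[of t] sum_list_parts[of t'] arg_cong[OF parts, of sum_mset] t p't
    by (simp add: sum_mset_sum_list sum_mset_replicate_mset)
  have two: "2 * real (maj q) + 2 * real (comaj q) = real (length q) * (real (length q) - 1)" for q
    using arg_cong[OF maj_add_comaj[of q], of real] by (cases "length q") (auto simp: algebra_simps)
  have choose: "2 * real (m choose 2) = real m * (real m - 1)"
    by (induction m) (auto simp: numeral_2_eq_2 algebra_simps)
  have rc: "real (comaj p') = real (comaj p) - real (add \<alpha>)
      + real m * real (length p) + real r * real (m choose 2)"
    using arg_cong[OF comaj, of real] by simp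
  moreover have "real (maj p') = real (maj p) + real (add \<alpha>)
      + real m * (real r - 1) * (real (length p) + real r * real m / 2)"
  proof -
    have "2 * real (maj p') = (real (length p) + real r * real m) * (real (length p) + real r * real m - 1)
        - 2 * real (comaj p')"
      using two[of p'] by (simp add: len)
    also have "\<dots> = (real (length p) + real r * real m) * (real (length p) + real r * real m - 1)
        - 2 * real (comaj p) + 2 * real (add \<alpha>) - 2 * real m * real (length p)
        - real r * (real m * (real m - 1))"
      unfolding choose[symmetric] rc by (simp add: algebra_simps)
    also have "2 * real (comaj p) = real (length p) * (real (length p) - 1) - 2 * real (maj p)"
      using two[of p] by simp
    finally show ?thesis by (simp add: field_simps)
  qed
  ultimately show ?thesis by blast
qed

end
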